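(* Let $k$ be a field, let $A$ be an infinite set, and let $R=k[x_\alpha:\alpha\in A]$ be the commutative ring of polynomials over $k$ in the infinitely many variables $x_\alpha$, $\alpha\in A$. Let $$0\longleftarrow k\longleftarrow P_0\longleftarrow P_1\longleftarrow P_2\longleftarrow\cdots$$ be a projective resolution, in the category of $R$-modules, of the one-dimensional $R$-module $k$ on which all the elements $x_\alpha$ act by zero. Let $P$ be a projective $R$-module such that the $R$-module $P_n$ is a direct summand of $P$ for every $n\ge0$. Then the complex $$0\longrightarrow\operatorname{Hom}_R(P_0,P)\longrightarrow\operatorname{Hom}_R(P_1,P)\longrightarrow\operatorname{Hom}_R(P_2,P)\longrightarrow\cdots$$ obtained by applying the contravariant functor $\operatorname{Hom}_R(-,P)$ to the truncated resolution $0\leftarrow P_0\leftarrow P_1\leftarrow P_2\leftarrow\cdots$ is a bounded below, noncontractible, acyclic complex of finitely generated projective left modules over the ring $S=\operatorname{Hom}_R(P,P)$.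
   Context: Here $S=\operatorname{Hom}_R(P,P)$ is the endomorphism ring of $P$; for any $R$-module $M$ the abelian group $\operatorname{Hom}_R(M,P)$ is a left $S$-module via postcomposition. Complexes are cohomologically graded; bounded below means that the terms vanish in all sufficiently negative degrees. A complex is contractible if its identity endomorphism is homotopic to zero; noncontractible means not contractible (as a complex of left $S$-modules). *)

theory Defs
  imports "HOL-Algebra.Module" "HOL-Library.Poly_Mapping"
begin

section \<open>Left modules over a not necessarily commutative ring\<close>

text \<open>The library's \<^locale>\<open>module\<close> requires a commutative ring of scalars. The locale below has the
  same axioms over an arbitrary ring. As in the library, the fields \<^const>\<open>mult\<close> and
  \<^const>\<open>one\<close> of a module record carry no meaning.\<close>

locale left_module = R?: ring R + M?: abelian_group M
  for R :: "('r, 'u) ring_scheme" (structure) and M :: "('r, 'm, 'v) module_scheme" (structure) +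
  assumes smult_closed [simp, intro]:
      "a \<in> carrier R \<Longrightarrow> x \<in> carrier M \<Longrightarrow> a \<odot>\<^bsub>M\<^esub> x \<in> carrier M"
    and smult_l_distr:
      "a \<in> carrier R \<Longrightarrow> b \<in> carrier R \<Longrightarrow> x \<in> carrier M \<Longrightarrow>
        (a \<oplus> b) \<odot>\<^bsub>M\<^esub> x = a \<odot>\<^bsub>M\<^esub> x \<oplus>\<^bsub>M\<^esub> b \<odot>\<^bsub>M\<^esub> x"
    and smult_r_distr:
      "a \<in> carrier R \<Longrightarrow> x \<in> carrier M \<Longrightarrow> y \<in> carrier M \<Longrightarrow>
        a \<odot>\<^bsub>M\<^esub> (x \<oplus>\<^bsub>M\<^esub> y) = a \<odot>\<^bsub>M\<^esub> x \<oplus>\<^bsub>M\<^esub> a \<odot>\<^bsub>M\<^esub> y"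
    and smult_assoc1:
      "a \<in> carrier R \<Longrightarrow> b \<in> carrier R \<Longrightarrow> x \<in> carrier M \<Longrightarrow>
        (a \<otimes> b) \<odot>\<^bsub>M\<^esub> x = a \<odot>\<^bsub>M\<^esub> (b \<odot>\<^bsub>M\<^esub> x)"
    and smult_one [simp]:
      "x \<in> carrier M \<Longrightarrow> \<one> \<odot>\<^bsub>M\<^esub> x = x"

lemma module_iff_left_module: "module R M \<longleftrightarrow> cring R \<and> left_module R M"
  by (auto simp: module_def module_axioms_def left_module_def left_module_axioms_def cring_def)

text \<open>Homomorphisms are extensional (\<^const>\<open>undefined\<close> off the carrier), so that equality of
  elements of a Hom group is equality of functions on the carrier.\<close>

definition mod_hom ::
    "('r, 'u) ring_scheme \<Rightarrow> ('r, 'm, 'v) module_scheme \<Rightarrow> ('r, 'n, 'w) module_scheme \<Rightarrow> ('m \<Rightarrow> 'n) set"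
  where "mod_hom R M N =
    {f \<in> hom (add_monoid M) (add_monoid N) \<inter> extensional (carrier M).
       \<forall>a\<in>carrier R. \<forall>x\<in>carrier M. f (a \<odot>\<^bsub>M\<^esub> x) = a \<odot>\<^bsub>N\<^esub> f x}"

definition mod_isomorphic ::
    "('r, 'u) ring_scheme \<Rightarrow> ('r, 'm, 'v) module_scheme \<Rightarrow> ('r, 'n, 'w) module_scheme \<Rightarrow> bool"
  where "mod_isomorphic R M N \<longleftrightarrow> (\<exists>f\<in>mod_hom R M N. bij_betw f (carrier M) (carrier N))"

definition zero_module :: "('r, 'm) module"
  where "zero_module =
    \<lparr>carrier = {undefined}, mult = undefined, one = undefined,
     zero = undefined, add = (\<lambda>_ _. undefined), smult = (\<lambda>_ _. undefined)\<rparr>"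

definition zero_hom :: "('r, 'm, 'v) module_scheme \<Rightarrow> ('r, 'n, 'w) module_scheme \<Rightarrow> 'm \<Rightarrow> 'n"
  where "zero_hom M N = (\<lambda>x\<in>carrier M. \<zero>\<^bsub>N\<^esub>)"

definition direct_sum_module ::
    "('r, 'm, 'v) module_scheme \<Rightarrow> ('r, 'n, 'w) module_scheme \<Rightarrow> ('r, 'm \<times> 'n) module"
  where "direct_sum_module M N =
    \<lparr>carrier = carrier M \<times> carrier N, mult = undefined, one = undefined,
     zero = (\<zero>\<^bsub>M\<^esub>, \<zero>\<^bsub>N\<^esub>),
     add = (\<lambda>(x, y) (x', y'). (x \<oplus>\<^bsub>M\<^esub> x', y \<oplus>\<^bsub>N\<^esub> y')),
     smult = (\<lambda>a (x, y). (a \<odot>\<^bsub>M\<^esub> x, a \<odot>\<^bsub>N\<^esub> y))\<rparr>"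

text \<open>The complement may be taken with elements in the type of the ambient module, since it embeds
  in that module.\<close>

definition direct_summand ::
    "('r, 'u) ring_scheme \<Rightarrow> ('r, 'm, 'v) module_scheme \<Rightarrow> ('r, 'n, 'w) module_scheme \<Rightarrow> bool"
  where "direct_summand R M N \<longleftrightarrow> left_module R M \<and> left_module R N \<and>
    (\<exists>K :: ('r, 'n) module. left_module R K \<and> mod_isomorphic R (direct_sum_module M K) N)"

definition free_module :: "('r, 'u) ring_scheme \<Rightarrow> 'i set \<Rightarrow> ('r, 'i \<Rightarrow> 'r) module"
  where "free_module R I =
    \<lparr>carrier = {f \<in> I \<rightarrow>\<^sub>E carrier R. finite {i \<in> I. f i \<noteq> \<zero>\<^bsub>R\<^esub>}},
     mult = undefined, one = undefined,
     zero = (\<lambda>i\<in>I. \<zero>\<^bsub>R\<^esub>),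
     add = (\<lambda>f g. \<lambda>i\<in>I. f i \<oplus>\<^bsub>R\<^esub> g i),
     smult = (\<lambda>a f. \<lambda>i\<in>I. a \<otimes>\<^bsub>R\<^esub> f i)\<rparr>"

text \<open>Projective means: direct summand of a free module. Letting the basis range over subsets of the
  element type of \<open>M\<close> loses no generality: if \<open>M\<close> is a direct summand of some free module, then the
  canonical surjection onto \<open>M\<close> from the free module with basis the carrier of \<open>M\<close> splits.\<close>

definition projective_module :: "('r, 'u) ring_scheme \<Rightarrow> ('r, 'm, 'v) module_scheme \<Rightarrow> bool"
  where "projective_module R M \<longleftrightarrow> (\<exists>I :: 'm set. direct_summand R M (free_module R I))"

definition finitely_generated_module ::
    "('r, 'u) ring_scheme \<Rightarrow> ('r, 'm, 'v) module_scheme \<Rightarrow> bool"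
  where "finitely_generated_module R M \<longleftrightarrow> left_module R M \<and>
    (\<exists>X. finite X \<and> X \<subseteq> carrier M \<and>
      (\<forall>y\<in>carrier M. \<exists>c \<in> X \<rightarrow> carrier R. y = (\<Oplus>\<^bsub>M\<^esub>x\<in>X. c x \<odot>\<^bsub>M\<^esub> x)))"


section \<open>Endomorphism rings and Hom modules\<close>

definition End_ring ::
    "('r, 'u) ring_scheme \<Rightarrow> ('r, 'p, 'v) module_scheme \<Rightarrow> ('p \<Rightarrow> 'p) ring"
  where "End_ring R P =
    \<lparr>carrier = mod_hom R P P,
     mult = (\<lambda>f g. compose (carrier P) f g),
     one = (\<lambda>x\<in>carrier P. x),
     zero = zero_hom P P,
     add = (\<lambda>f g. \<lambda>x\<in>carrier P. f x \<oplus>\<^bsub>P\<^esub> g x)\<rparr>"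

text \<open>The scalars of the following module are the elements of \<^term>\<open>End_ring R P\<close>, acting by
  postcomposition.\<close>

definition Hom_module ::
    "('r, 'u) ring_scheme \<Rightarrow> ('r, 'm, 'v) module_scheme \<Rightarrow> ('r, 'p, 'w) module_scheme
      \<Rightarrow> ('p \<Rightarrow> 'p, 'm \<Rightarrow> 'p) module"
  where "Hom_module R M P =
    \<lparr>carrier = mod_hom R M P, mult = undefined, one = undefined,
     zero = zero_hom M P,
     add = (\<lambda>f g. \<lambda>x\<in>carrier M. f x \<oplus>\<^bsub>P\<^esub> g x),
     smult = (\<lambda>s f. compose (carrier M) s f)\<rparr>"


section \<open>Complexes of left modules, cohomologically graded by the integers\<close>

text \<open>The differential \<open>d n\<close> goes from \<open>C n\<close> to \<open>C (n + 1)\<close>.\<close>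

definition cochain_complex ::
    "('r, 'u) ring_scheme \<Rightarrow> (int \<Rightarrow> ('r, 'm) module) \<Rightarrow> (int \<Rightarrow> 'm \<Rightarrow> 'm) \<Rightarrow> bool"
  where "cochain_complex R C d \<longleftrightarrow>
    (\<forall>n. left_module R (C n)) \<and>
    (\<forall>n. d n \<in> mod_hom R (C n) (C (n + 1))) \<and>
    (\<forall>n. \<forall>x\<in>carrier (C n). d (n + 1) (d n x) = \<zero>\<^bsub>C (n + 2)\<^esub>)"

definition bounded_below_complex :: "(int \<Rightarrow> ('r, 'm) module) \<Rightarrow> bool"
  where "bounded_below_complex C \<longleftrightarrow> (\<exists>N. \<forall>n<N. carrier (C n) = {\<zero>\<^bsub>C n\<^esub>})"

definition acyclic_complex :: "(int \<Rightarrow> ('r, 'm) module) \<Rightarrow> (int \<Rightarrow> 'm \<Rightarrow> 'm) \<Rightarrow> bool"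
  where "acyclic_complex C d \<longleftrightarrow>
    (\<forall>n. {x \<in> carrier (C n). d n x = \<zero>\<^bsub>C (n + 1)\<^esub>} = d (n - 1) ` carrier (C (n - 1)))"

definition null_homotopic ::
    "('r, 'u) ring_scheme \<Rightarrow> (int \<Rightarrow> ('r, 'm) module) \<Rightarrow> (int \<Rightarrow> 'm \<Rightarrow> 'm) \<Rightarrow>
      (int \<Rightarrow> ('r, 'n) module) \<Rightarrow> (int \<Rightarrow> 'n \<Rightarrow> 'n) \<Rightarrow> (int \<Rightarrow> 'm \<Rightarrow> 'n) \<Rightarrow> bool"
  where "null_homotopic R C d C' d' f \<longleftrightarrow>
    (\<exists>h. (\<forall>n. h n \<in> mod_hom R (C n) (C' (n - 1))) \<and>
      (\<forall>n. \<forall>x\<in>carrier (C n). f n x = d' (n - 1) (h n x) \<oplus>\<^bsub>C' n\<^esub> h (n + 1) (d n x)))"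

definition contractible_complex ::
    "('r, 'u) ring_scheme \<Rightarrow> (int \<Rightarrow> ('r, 'm) module) \<Rightarrow> (int \<Rightarrow> 'm \<Rightarrow> 'm) \<Rightarrow> bool"
  where "contractible_complex R C d \<longleftrightarrow> null_homotopic R C d C d (\<lambda>n. \<lambda>x\<in>carrier (C n). x)"


section \<open>Projective resolutions and the complex of homomorphisms\<close>

definition projective_resolution ::
    "('r, 'u) ring_scheme \<Rightarrow> (nat \<Rightarrow> ('r, 'm) module) \<Rightarrow> (nat \<Rightarrow> 'm \<Rightarrow> 'm) \<Rightarrow> ('m \<Rightarrow> 'n) \<Rightarrow>
      ('r, 'n) module \<Rightarrow> bool"
  where "projective_resolution R P d \<epsilon> M \<longleftrightarrow>
    left_module R M \<and>
    (\<forall>n. projective_module R (P n)) \<and>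
    (\<forall>n. d n \<in> mod_hom R (P (Suc n)) (P n)) \<and>
    \<epsilon> \<in> mod_hom R (P 0) M \<and>
    \<epsilon> ` carrier (P 0) = carrier M \<and>
    {x \<in> carrier (P 0). \<epsilon> x = \<zero>\<^bsub>M\<^esub>} = d 0 ` carrier (P 1) \<and>
    (\<forall>n. {x \<in> carrier (P (Suc n)). d n x = \<zero>\<^bsub>P n\<^esub>} = d (Suc n) ` carrier (P (Suc (Suc n))))"

text \<open>The truncated resolution, extended by zero to a homologically graded complex indexed by the
  integers; the differential \<open>truncated_diff P d n\<close> goes from degree \<open>n + 1\<close> to degree \<open>n\<close>.\<close>

definition truncated_obj :: "(nat \<Rightarrow> ('r, 'm) module) \<Rightarrow> int \<Rightarrow> ('r, 'm) module"
  where "truncated_obj P n = (if 0 \<le> n then P (nat n) else zero_module)"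

definition truncated_diff ::
    "(nat \<Rightarrow> ('r, 'm) module) \<Rightarrow> (nat \<Rightarrow> 'm \<Rightarrow> 'm) \<Rightarrow> int \<Rightarrow> 'm \<Rightarrow> 'm"
  where "truncated_diff P d n =
    (if 0 \<le> n then d (nat n) else zero_hom (truncated_obj P (n + 1)) (truncated_obj P n))"

definition Hom_complex_obj ::
    "('r, 'u) ring_scheme \<Rightarrow> (int \<Rightarrow> ('r, 'm) module) \<Rightarrow> ('r, 'p) module
      \<Rightarrow> int \<Rightarrow> ('p \<Rightarrow> 'p, 'm \<Rightarrow> 'p) module"
  where "Hom_complex_obj R T Q n = Hom_module R (T n) Q"

definition Hom_complex_diff ::
    "('r, 'u) ring_scheme \<Rightarrow> (int \<Rightarrow> ('r, 'm) module) \<Rightarrow> (int \<Rightarrow> 'm \<Rightarrow> 'm) \<Rightarrow> ('r, 'p) module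
      \<Rightarrow> int \<Rightarrow> ('m \<Rightarrow> 'p) \<Rightarrow> ('m \<Rightarrow> 'p)"
  where "Hom_complex_diff R T D Q n =
    (\<lambda>f\<in>mod_hom R (T n) Q. compose (carrier (T (n + 1))) f (D n))"


section \<open>Polynomials over a field in the variables of a set \<open>A\<close>\<close>

text \<open>A polynomial is a finitely supported function from monomials to coefficients; a monomial is a
  finitely supported function from variables to exponents.\<close>

definition poly_ring :: "'x set \<Rightarrow> (('x \<Rightarrow>\<^sub>0 nat) \<Rightarrow>\<^sub>0 'k::field) ring"
  where "poly_ring A =
    \<lparr>carrier = {p. \<forall>m\<in>Poly_Mapping.keys p. Poly_Mapping.keys m \<subseteq> A},
     mult = (*), one = 1, zero = 0, add = (+)\<rparr>"

text \<open>The field as a module on which all variables act by zero: a polynomial acts through its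
  constant coefficient.\<close>

definition residue_module :: "(('x \<Rightarrow>\<^sub>0 nat) \<Rightarrow>\<^sub>0 'k::field, 'k) module"
  where "residue_module =
    \<lparr>carrier = UNIV, mult = undefined, one = undefined, zero = 0, add = (+),
     smult = (\<lambda>p c. Poly_Mapping.lookup p 0 * c)\<rparr>"

end

theory Submission
  imports Defs
begin

text \<open>Acyclicity is Rees's argument. Variables \<open>x\<^sub>1, \<dots>, x\<^sub>n\<close> form a regular sequence on a free
  module, hence on \<open>Q\<close>, and annihilate \<open>k\<close>, so that multiplication by each of them is null-homotopic
  on the resolution; this kills \<open>Ext\<^sup>i(k, Q)\<close> for \<open>i < n\<close>. As there are infinitely many variables,
  all Ext groups vanish. The induction uses congruences modulo \<open>x\<^sub>1Q + \<dots> + x\<^sub>nQ\<close> in place of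
  quotients of \<open>Q\<close>. A contracting homotopy, on the other hand, would come from a splitting of
  \<open>P\<^sub>1 \<rightarrow> P\<^sub>0\<close>, because \<open>Hom(-, Q)\<close> is fully faithful on retracts of \<open>Q\<close>; then \<open>k\<close> would be
  zero. Finally, \<open>Hom(P\<^sub>n, Q)\<close> is a retract of \<open>Hom(Q, Q) = S\<close>.\<close>


section \<open>Left modules and their homomorphisms\<close>

text \<open>Rees's induction changes the coefficient module at every step: degree n + 1 for
  \<open>Q\<close> leads to degree n for \<open>Q\<close> modulo one more variable. The elements of
  a quotient are cosets, so the type would change along the induction, which one inductive statement
  over a fixed type cannot express. Hence \<open>Q\<close> stays fixed and a list of ring elements
  spanning the submodule varies. A cocycle is then a map into \<open>Q\<close> whose composite with
  the differential lands in the submodule, and a map into a quotient is replaced by one lifted to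
  \<open>Q\<close>; the lifts exist because the terms of the resolution are projective.

  Each descent by one degree spends one variable and degree zero spends another, so degree n takes n
  + 1 of them. Infinitely many are essential: over a polynomial ring R in exactly n variables, the
  n-th Ext group of k with values in R is nonzero.\<close>

context left_module
begin

lemma smult_r_zero [simp]:
  assumes "a \<in> carrier R"
  shows "a \<odot>\<^bsub>M\<^esub> \<zero>\<^bsub>M\<^esub> = \<zero>\<^bsub>M\<^esub>"
  using smult_r_distr[OF assms, of "\<zero>\<^bsub>M\<^esub>" "\<zero>\<^bsub>M\<^esub>"] assms by simp

lemma smult_l_zero [simp]:
  assumes "x \<in> carrier M"
  shows "\<zero> \<odot>\<^bsub>M\<^esub> x = \<zero>\<^bsub>M\<^esub>"
  using smult_l_distr[of \<zero> \<zero> x] assms by simp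

lemma smult_r_minus:
  assumes "a \<in> carrier R" "x \<in> carrier M"
  shows "a \<odot>\<^bsub>M\<^esub> (\<ominus>\<^bsub>M\<^esub> x) = \<ominus>\<^bsub>M\<^esub> (a \<odot>\<^bsub>M\<^esub> x)"
  using smult_r_distr[of a "\<ominus>\<^bsub>M\<^esub> x" x] assms
  by (intro M.minus_equality[symmetric]) (auto simp: M.l_neg)

lemma smult_r_diff:
  assumes "a \<in> carrier R" "x \<in> carrier M" "y \<in> carrier M"
  shows "a \<odot>\<^bsub>M\<^esub> (x \<ominus>\<^bsub>M\<^esub> y) = a \<odot>\<^bsub>M\<^esub> x \<ominus>\<^bsub>M\<^esub> a \<odot>\<^bsub>M\<^esub> y"
  using assms by (simp add: M.minus_eq smult_r_distr smult_r_minus)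

end

section \<open>Differences in abelian groups\<close>

lemma (in abelian_group) diff_zero_iff:
  assumes "x \<in> carrier G" "y \<in> carrier G"
  shows "x \<ominus> y = \<zero> \<longleftrightarrow> x = y"
  using assms by (metis add.inv_closed add.inv_inv minus_equality minus_eq r_neg)

lemma (in abelian_group) diff_zero [simp]:
  assumes "x \<in> carrier G"
  shows "x \<ominus> \<zero> = x"
  using assms by (simp add: minus_eq)

lemma (in abelian_group) diff_add_diff:
  assumes "a \<in> carrier G" "b \<in> carrier G" "c \<in> carrier G" "d \<in> carrier G"
  shows "(a \<oplus> b) \<ominus> (c \<oplus> d) = (a \<ominus> c) \<oplus> (b \<ominus> d)"
  using assms by (simp add: minus_eq minus_add a_ac)

lemma (in abelian_group) diff_add_cancel:
  assumes "a \<in> carrier G" "b \<in> carrier G"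
  shows "(a \<ominus> b) \<oplus> b = a"
  using assms by (simp add: minus_eq a_assoc l_neg)

lemma (in abelian_group) diff_add_diff_cancel:
  assumes "a \<in> carrier G" "b \<in> carrier G" "c \<in> carrier G"
  shows "(a \<ominus> b) \<oplus> (b \<ominus> c) = a \<ominus> c"
  using assms by (metis a_assoc a_inv_closed diff_add_cancel minus_closed minus_eq)

lemma (in abelian_group) add_diff_cancel:
  assumes "a \<in> carrier G" "b \<in> carrier G"
  shows "(a \<oplus> b) \<ominus> b = a"
  using assms by (simp add: minus_eq a_assoc r_neg)

lemma left_moduleI:
  fixes R (structure) and M (structure)
  assumes "ring R" "abelian_group M"
    and "\<And>a x. \<lbrakk>a \<in> carrier R; x \<in> carrier M\<rbrakk> \<Longrightarrow> a \<odot>\<^bsub>M\<^esub> x \<in> carrier M"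
    and "\<And>a b x. \<lbrakk>a \<in> carrier R; b \<in> carrier R; x \<in> carrier M\<rbrakk> \<Longrightarrow>
      (a \<oplus> b) \<odot>\<^bsub>M\<^esub> x = a \<odot>\<^bsub>M\<^esub> x \<oplus>\<^bsub>M\<^esub> b \<odot>\<^bsub>M\<^esub> x"
    and "\<And>a x y. \<lbrakk>a \<in> carrier R; x \<in> carrier M; y \<in> carrier M\<rbrakk> \<Longrightarrow>
      a \<odot>\<^bsub>M\<^esub> (x \<oplus>\<^bsub>M\<^esub> y) = a \<odot>\<^bsub>M\<^esub> x \<oplus>\<^bsub>M\<^esub> a \<odot>\<^bsub>M\<^esub> y"
    and "\<And>a b x. \<lbrakk>a \<in> carrier R; b \<in> carrier R; x \<in> carrier M\<rbrakk> \<Longrightarrow>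
      (a \<otimes> b) \<odot>\<^bsub>M\<^esub> x = a \<odot>\<^bsub>M\<^esub> (b \<odot>\<^bsub>M\<^esub> x)"
    and "\<And>x. x \<in> carrier M \<Longrightarrow> \<one> \<odot>\<^bsub>M\<^esub> x = x"
  shows "left_module R M"
  using assms by (auto simp: left_module_def left_module_axioms_def)

lemma left_module_abelian_group: "left_module R M \<Longrightarrow> abelian_group M"
  by (simp add: left_module_def)

lemma left_module_ring: "left_module R M \<Longrightarrow> ring R"
  by (simp add: left_module_def)

section \<open>Linear maps and operations on them\<close>

lemma mod_homI:
  assumes "\<And>x. x \<in> carrier M \<Longrightarrow> f x \<in> carrier N"
    and "\<And>x y. \<lbrakk>x \<in> carrier M; y \<in> carrier M\<rbrakk> \<Longrightarrow> f (x \<oplus>\<^bsub>M\<^esub> y) = f x \<oplus>\<^bsub>N\<^esub> f y"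
    and "\<And>a x. \<lbrakk>a \<in> carrier R; x \<in> carrier M\<rbrakk> \<Longrightarrow> f (a \<odot>\<^bsub>M\<^esub> x) = a \<odot>\<^bsub>N\<^esub> f x"
    and "f \<in> extensional (carrier M)"
  shows "f \<in> mod_hom R M N"
  using assms by (auto simp: mod_hom_def hom_def)

lemma mod_hom_restrictI:
  assumes "left_module R M"
    and "\<And>x. x \<in> carrier M \<Longrightarrow> f x \<in> carrier N"
    and "\<And>x y. \<lbrakk>x \<in> carrier M; y \<in> carrier M\<rbrakk> \<Longrightarrow> f (x \<oplus>\<^bsub>M\<^esub> y) = f x \<oplus>\<^bsub>N\<^esub> f y"
    and "\<And>a x. \<lbrakk>a \<in> carrier R; x \<in> carrier M\<rbrakk> \<Longrightarrow> f (a \<odot>\<^bsub>M\<^esub> x) = a \<odot>\<^bsub>N\<^esub> f x"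
  shows "(\<lambda>x\<in>carrier M. f x) \<in> mod_hom R M N"
proof -
  interpret M: left_module R M by fact
  show ?thesis by (rule mod_homI) (auto simp: assms)
qed

lemma mod_hom_closed: "\<lbrakk>f \<in> mod_hom R M N; x \<in> carrier M\<rbrakk> \<Longrightarrow> f x \<in> carrier N"
  by (auto simp: mod_hom_def hom_def)

lemma mod_hom_add:
  "\<lbrakk>f \<in> mod_hom R M N; x \<in> carrier M; y \<in> carrier M\<rbrakk> \<Longrightarrow> f (x \<oplus>\<^bsub>M\<^esub> y) = f x \<oplus>\<^bsub>N\<^esub> f y"
  by (auto simp: mod_hom_def hom_def)

lemma mod_hom_smult:
  "\<lbrakk>f \<in> mod_hom R M N; a \<in> carrier R; x \<in> carrier M\<rbrakk> \<Longrightarrow> f (a \<odot>\<^bsub>M\<^esub> x) = a \<odot>\<^bsub>N\<^esub> f x"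
  by (auto simp: mod_hom_def)

lemma mod_hom_extensional: "f \<in> mod_hom R M N \<Longrightarrow> f \<in> extensional (carrier M)"
  by (auto simp: mod_hom_def)

lemma mod_hom_eqI:
  assumes "f \<in> mod_hom R M N" "g \<in> mod_hom R M N'" "\<And>x. x \<in> carrier M \<Longrightarrow> f x = g x"
  shows "f = g"
  using assms by (meson extensionalityI mod_hom_extensional)

lemma mod_hom_zero:
  assumes "f \<in> mod_hom R M N" "abelian_group M" "abelian_group N"
  shows "f \<zero>\<^bsub>M\<^esub> = \<zero>\<^bsub>N\<^esub>"
proof -
  interpret M: abelian_group M by fact
  interpret N: abelian_group N by fact
  have "f \<zero>\<^bsub>M\<^esub> \<oplus>\<^bsub>N\<^esub> f \<zero>\<^bsub>M\<^esub> = f \<zero>\<^bsub>M\<^esub>"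
    using mod_hom_add[OF assms(1), of "\<zero>\<^bsub>M\<^esub>" "\<zero>\<^bsub>M\<^esub>"] by simp
  then show ?thesis using mod_hom_closed[OF assms(1), of "\<zero>\<^bsub>M\<^esub>"] by simp
qed

lemma mod_hom_minus:
  assumes "f \<in> mod_hom R M N" "abelian_group M" "abelian_group N" "x \<in> carrier M"
  shows "f (\<ominus>\<^bsub>M\<^esub> x) = \<ominus>\<^bsub>N\<^esub> f x"
proof -
  interpret M: abelian_group M by fact
  interpret N: abelian_group N by fact
  have "f (\<ominus>\<^bsub>M\<^esub> x) \<oplus>\<^bsub>N\<^esub> f x = \<zero>\<^bsub>N\<^esub>"
    using mod_hom_add[OF assms(1), of "\<ominus>\<^bsub>M\<^esub> x" x] assms mod_hom_zero[OF assms(1-3)]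
    by (simp add: M.l_neg)
  then show ?thesis using mod_hom_closed[OF assms(1)] assms
    by (simp add: N.minus_equality)
qed

lemma mod_hom_diff:
  assumes "f \<in> mod_hom R M N" "abelian_group M" "abelian_group N" "x \<in> carrier M" "y \<in> carrier M"
  shows "f (x \<ominus>\<^bsub>M\<^esub> y) = f x \<ominus>\<^bsub>N\<^esub> f y"
proof -
  interpret M: abelian_group M by fact
  interpret N: abelian_group N by fact
  show ?thesis
    using assms by (simp add: M.minus_eq N.minus_eq mod_hom_add[OF assms(1)] mod_hom_minus)
qed

lemma mod_hom_compose:
  assumes "left_module R M" "f \<in> mod_hom R M N" "g \<in> mod_hom R N L"
  shows "compose (carrier M) g f \<in> mod_hom R M L"
  unfolding compose_def using assms
  by (intro mod_hom_restrictI) (auto simp: mod_hom_closed mod_hom_add mod_hom_smult)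

lemma mod_hom_plus:
  assumes "left_module R M" "left_module R N" "f \<in> mod_hom R M N" "g \<in> mod_hom R M N"
  shows "(\<lambda>x\<in>carrier M. f x \<oplus>\<^bsub>N\<^esub> g x) \<in> mod_hom R M N"
proof -
  interpret N: left_module R N by fact
  show ?thesis using assms
    by (intro mod_hom_restrictI)
      (auto simp: mod_hom_closed mod_hom_add mod_hom_smult N.smult_r_distr N.M.a_ac)
qed

lemma mod_hom_uminus:
  assumes "left_module R M" "left_module R N" "f \<in> mod_hom R M N"
  shows "(\<lambda>x\<in>carrier M. \<ominus>\<^bsub>N\<^esub> f x) \<in> mod_hom R M N"
proof -
  interpret N: left_module R N by fact
  show ?thesis using assms
    by (intro mod_hom_restrictI)
      (auto simp: mod_hom_closed mod_hom_add mod_hom_smult N.smult_r_minus N.M.minus_add)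
qed

lemma mod_hom_minus_hom:
  assumes "left_module R M" "left_module R N" "f \<in> mod_hom R M N" "g \<in> mod_hom R M N"
  shows "(\<lambda>x\<in>carrier M. f x \<ominus>\<^bsub>N\<^esub> g x) \<in> mod_hom R M N"
proof -
  interpret N: left_module R N by fact
  show ?thesis using assms
    by (intro mod_hom_restrictI)
      (auto simp: mod_hom_closed mod_hom_add mod_hom_smult N.smult_r_diff N.M.diff_add_diff)
qed

lemma mod_hom_zero_hom:
  assumes "left_module R M" "left_module R N"
  shows "zero_hom M N \<in> mod_hom R M N"
proof -
  interpret N: left_module R N by fact
  show ?thesis unfolding zero_hom_def using assms
    by (intro mod_hom_restrictI) auto
qed

lemma mod_hom_id:
  assumes "left_module R M"
  shows "(\<lambda>x\<in>carrier M. x) \<in> mod_hom R M M"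
  using assms by (intro mod_hom_restrictI) auto

text \<open>Commutativity of the scalars makes a homothety linear. As a linear map it can be lifted
  against, and lifted through, like any other.\<close>

lemma mod_hom_homothety:
  assumes "cring R" "left_module R M" "a \<in> carrier R"
  shows "(\<lambda>x\<in>carrier M. a \<odot>\<^bsub>M\<^esub> x) \<in> mod_hom R M M"
proof -
  interpret M: left_module R M by fact
  interpret R: cring R by fact
  show ?thesis using assms
    by (intro mod_hom_restrictI)
      (auto simp: M.smult_r_distr M.smult_assoc1[symmetric] R.m_comm)
qed

section \<open>Zero modules and direct sums\<close>

lemma left_module_zero_module:
  assumes "ring R"
  shows "left_module R zero_module"
proof -
  have "abelian_group (zero_module :: ('a, 'c) module)"
    by (rule abelian_groupI) (auto simp: zero_module_def)
  then show ?thesis using assms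
    by (intro left_moduleI) (auto simp: zero_module_def)
qed

lemma carrier_direct_sum:
  "carrier (direct_sum_module M N) = carrier M \<times> carrier N"
  by (simp add: direct_sum_module_def)

lemma left_module_direct_sum:
  assumes "left_module R M" "left_module R N"
  shows "left_module R (direct_sum_module M N)"
proof -
  interpret M: left_module R M by fact
  interpret N: left_module R N by fact
  have "abelian_group (direct_sum_module M N)"
  proof (rule abelian_groupI)
    fix x assume "x \<in> carrier (direct_sum_module M N)"
    then show "\<exists>y\<in>carrier (direct_sum_module M N).
        y \<oplus>\<^bsub>direct_sum_module M N\<^esub> x = \<zero>\<^bsub>direct_sum_module M N\<^esub>"
      by (intro bexI[of _ "(\<ominus>\<^bsub>M\<^esub> fst x, \<ominus>\<^bsub>N\<^esub> snd x)"])
        (auto simp: direct_sum_module_def M.M.l_neg N.M.l_neg)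
  qed (auto simp: direct_sum_module_def M.M.a_ac N.M.a_ac)
  then show ?thesis
    by (intro left_moduleI)
      (auto simp: direct_sum_module_def M.R.ring_axioms M.smult_l_distr N.smult_l_distr
        M.smult_r_distr N.smult_r_distr M.smult_assoc1 N.smult_assoc1)
qed

lemma mod_hom_from_zero_module:
  assumes "abelian_group N" "f \<in> mod_hom R (zero_module :: ('r, 'm) module) N"
  shows "f = zero_hom zero_module N"
proof -
  have "abelian_group (zero_module :: ('r, 'm) module)"
    by (rule abelian_groupI) (auto simp: zero_module_def)
  then have "f undefined = \<zero>\<^bsub>N\<^esub>"
    using mod_hom_zero[OF assms(2) _ assms(1)] by (simp add: zero_module_def)
  then show ?thesis
    using mod_hom_extensional[OF assms(2)]
    by (auto simp: zero_hom_def zero_module_def extensional_def)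
qed


section \<open>Submodules\<close>

lemma (in left_module) submodule_zero: "submodule J R M \<Longrightarrow> \<zero>\<^bsub>M\<^esub> \<in> J"
  using subgroup.one_closed[of J "add_monoid M"] by (simp add: submodule_def)

lemma (in left_module) submodule_subset: "submodule J R M \<Longrightarrow> J \<subseteq> carrier M"
  using subgroup.subset[of J "add_monoid M"] by (simp add: submodule_def)

lemma (in left_module) submodule_add:
  "\<lbrakk>submodule J R M; x \<in> J; y \<in> J\<rbrakk> \<Longrightarrow> x \<oplus>\<^bsub>M\<^esub> y \<in> J"
  using subgroup.m_closed[of J "add_monoid M" x y] by (simp add: submodule_def)

lemma (in left_module) submodule_minus: "\<lbrakk>submodule J R M; x \<in> J\<rbrakk> \<Longrightarrow> \<ominus>\<^bsub>M\<^esub> x \<in> J"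
  using subgroup.m_inv_closed[of J "add_monoid M" x] by (simp add: submodule_def a_inv_def)

lemma (in left_module) submoduleI:
  assumes "J \<subseteq> carrier M" "\<zero>\<^bsub>M\<^esub> \<in> J"
    and "\<And>x. x \<in> J \<Longrightarrow> \<ominus>\<^bsub>M\<^esub> x \<in> J"
    and "\<And>x y. \<lbrakk>x \<in> J; y \<in> J\<rbrakk> \<Longrightarrow> x \<oplus>\<^bsub>M\<^esub> y \<in> J"
    and "\<And>a x. \<lbrakk>a \<in> carrier R; x \<in> J\<rbrakk> \<Longrightarrow> a \<odot>\<^bsub>M\<^esub> x \<in> J"
  shows "submodule J R M"
  using assms by (auto intro!: submodule.intro subgroup.intro submodule_axioms.intro
      simp: a_inv_def)

lemma submodule_vimage:
  assumes "left_module R M" "left_module R N" "f \<in> mod_hom R M N" "submodule J R N"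
  shows "submodule {x \<in> carrier M. f x \<in> J} R M"
proof -
  interpret M: left_module R M by fact
  interpret N: left_module R N by fact
  show ?thesis
    using assms
    by (intro M.submoduleI)
      (auto simp: N.submodule_zero N.submodule_add N.submodule_minus submodule.smult_closed
        mod_hom_zero mod_hom_add mod_hom_minus mod_hom_smult M.M.abelian_group_axioms
        N.M.abelian_group_axioms)
qed

lemma (in left_module) submodule_singleton_zero: "submodule {\<zero>\<^bsub>M\<^esub>} R M"
  by (rule submoduleI) auto

text \<open>The record is spelled out because it serves as the complement in
  \<open>direct_summand\<close>, whose elements must have the type of the ambient module.\<close>

lemma (in left_module) left_module_submodule:
  assumes J: "submodule J R M"
  shows "left_module R
    \<lparr>carrier = J, mult = undefined, one = undefined, zero = \<zero>\<^bsub>M\<^esub>, add = (\<oplus>\<^bsub>M\<^esub>), smult = (\<odot>\<^bsub>M\<^esub>)\<rparr>"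
    (is "left_module R ?K")
proof -
  have sub: "x \<in> carrier M" if "x \<in> J" for x
    using that submodule_subset[OF J] by blast
  have "abelian_group ?K"
  proof (rule abelian_groupI)
    fix x assume "x \<in> carrier ?K"
    then show "\<exists>y\<in>carrier ?K. y \<oplus>\<^bsub>?K\<^esub> x = \<zero>\<^bsub>?K\<^esub>"
      using submodule_minus[OF J] sub by (intro bexI[of _ "\<ominus>\<^bsub>M\<^esub> x"]) (auto simp: M.l_neg)
  qed (auto simp: submodule_add[OF J] submodule_zero[OF J] sub M.a_ac)
  then show ?thesis
    by (intro left_moduleI)
      (auto simp: R.ring_axioms submodule.smult_closed[OF J] sub smult_l_distr smult_r_distr
        smult_assoc1)
qed


section \<open>Retracts and direct summands\<close>

text \<open>For left modules this is equivalent to \<open>direct_summand\<close>, but it mentions no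
  complement: a pair of maps can be composed directly, and it is the form in which summands are used
  below.\<close>

definition mod_retract ::
    "('r, 'u) ring_scheme \<Rightarrow> ('r, 'm, 'v) module_scheme \<Rightarrow> ('r, 'n, 'w) module_scheme \<Rightarrow> bool"
  where "mod_retract R M N \<longleftrightarrow>
    (\<exists>i\<in>mod_hom R M N. \<exists>p\<in>mod_hom R N M. \<forall>x\<in>carrier M. p (i x) = x)"

lemma direct_summand_imp_retract:
  fixes M :: "('r, 'm, 'v) module_scheme" and N :: "('r, 'n, 'w) module_scheme"
  assumes "direct_summand R M N"
  shows "mod_retract R M N"
proof -
  obtain K :: "('r, 'n) module" and f where
    mods: "left_module R M" "left_module R N" "left_module R K"
    and f: "f \<in> mod_hom R (direct_sum_module M K) N"
    and bij: "bij_betw f (carrier M \<times> carrier K) (carrier N)"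
    using assms by (auto simp: direct_summand_def mod_isomorphic_def carrier_direct_sum)
  interpret M: left_module R M by fact
  interpret N: left_module R N by fact
  interpret K: left_module R K by fact
  let ?D = "direct_sum_module M K"
  interpret D: left_module R ?D by (intro left_module_direct_sum mods)
  define g where "g = the_inv_into (carrier ?D) f"
  have cD: "carrier ?D = carrier M \<times> carrier K" by (simp add: direct_sum_module_def)
  have inj: "inj_on f (carrier ?D)" and surj: "f ` carrier ?D = carrier N"
    using bij cD by (auto simp: bij_betw_def)
  have gf: "g (f z) = z" if "z \<in> carrier ?D" for z
    using that inj by (simp add: g_def the_inv_into_f_f)
  have fst_add: "fst (z \<oplus>\<^bsub>?D\<^esub> w) = fst z \<oplus>\<^bsub>M\<^esub> fst w" for z w
    by (simp add: direct_sum_module_def split_beta)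
  have fst_smult: "fst (a \<odot>\<^bsub>?D\<^esub> z) = a \<odot>\<^bsub>M\<^esub> fst z" for a z
    by (simp add: direct_sum_module_def split_beta)
  have p: "(\<lambda>y\<in>carrier N. fst (g y)) \<in> mod_hom R N M"
  proof (rule mod_hom_restrictI[OF mods(2)])
    fix y assume "y \<in> carrier N"
    then obtain z where z: "z \<in> carrier ?D" "y = f z" using surj by blast
    then show "fst (g y) \<in> carrier M" using gf cD by auto
    fix a assume "a \<in> carrier R"
    then show "fst (g (a \<odot>\<^bsub>N\<^esub> y)) = a \<odot>\<^bsub>M\<^esub> fst (g y)"
      using z gf by (simp add: mod_hom_smult[OF f, symmetric] fst_smult)
  next
    fix x y assume "x \<in> carrier N" "y \<in> carrier N"
    then obtain z w where "z \<in> carrier ?D" "x = f z" "w \<in> carrier ?D" "y = f w"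
      using surj by blast
    then show "fst (g (x \<oplus>\<^bsub>N\<^esub> y)) = fst (g x) \<oplus>\<^bsub>M\<^esub> fst (g y)"
      using gf by (simp add: mod_hom_add[OF f, symmetric] fst_add)
  qed
  have add: "(x, \<zero>\<^bsub>K\<^esub>) \<oplus>\<^bsub>?D\<^esub> (y, \<zero>\<^bsub>K\<^esub>) = (x \<oplus>\<^bsub>M\<^esub> y, \<zero>\<^bsub>K\<^esub>)" for x y
    by (simp add: direct_sum_module_def)
  have smult: "a \<odot>\<^bsub>?D\<^esub> (x, \<zero>\<^bsub>K\<^esub>) = (a \<odot>\<^bsub>M\<^esub> x, \<zero>\<^bsub>K\<^esub>)" if "a \<in> carrier R" for a x
    using that by (simp add: direct_sum_module_def)
  have i: "(\<lambda>x\<in>carrier M. f (x, \<zero>\<^bsub>K\<^esub>)) \<in> mod_hom R M N"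
    using cD mod_hom_closed[OF f]
    by (intro mod_hom_restrictI[OF mods(1)])
      (auto simp: mod_hom_add[OF f, symmetric] mod_hom_smult[OF f, symmetric] add smult)
  show ?thesis
    unfolding mod_retract_def
    by (intro bexI[OF _ i] bexI[OF _ p]) (use gf cD mod_hom_closed[OF f] in auto)
qed

text \<open>The complement is the kernel of \<open>p\<close>: every y is the sum of
  \<open>i (p y)\<close> and a remainder that \<open>p\<close> kills.\<close>

lemma retract_imp_direct_summand:
  fixes M :: "('r, 'm, 'v) module_scheme" and N :: "('r, 'n, 'w) module_scheme"
  assumes mods: "left_module R M" "left_module R N" and "mod_retract R M N"
  shows "direct_summand R M N"
proof -
  interpret M: left_module R M by fact
  interpret N: left_module R N by fact
  obtain i p where i: "i \<in> mod_hom R M N" and p: "p \<in> mod_hom R N M"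
    and pi: "\<And>x. x \<in> carrier M \<Longrightarrow> p (i x) = x"
    using assms(3) by (auto simp: mod_retract_def)
  note ab = M.M.abelian_group_axioms N.M.abelian_group_axioms
  define J where "J = {y \<in> carrier N. p y \<in> {\<zero>\<^bsub>M\<^esub>}}"
  have J: "submodule J R N"
    unfolding J_def by (intro submodule_vimage[OF mods(2,1) p] M.submodule_singleton_zero)
  define K :: "('r, 'n) module" where "K = \<lparr>carrier = J, mult = undefined, one = undefined,
    zero = \<zero>\<^bsub>N\<^esub>, add = (\<oplus>\<^bsub>N\<^esub>), smult = (\<odot>\<^bsub>N\<^esub>)\<rparr>"
  have K: "left_module R K"
    unfolding K_def by (rule N.left_module_submodule[OF J])
  let ?D = "direct_sum_module M K"
  have cD: "carrier ?D = carrier M \<times> J"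
    by (simp add: direct_sum_module_def K_def)
  define f where "f = (\<lambda>z\<in>carrier ?D. i (fst z) \<oplus>\<^bsub>N\<^esub> snd z)"
  have ic: "i x \<in> carrier N" if "x \<in> carrier M" for x
    using that mod_hom_closed[OF i] by blast
  have Jc: "y \<in> carrier N" "p y = \<zero>\<^bsub>M\<^esub>" if "y \<in> J" for y
    using that by (auto simp: J_def)
  have f: "f \<in> mod_hom R ?D N"
    unfolding f_def
  proof (rule mod_hom_restrictI[OF left_module_direct_sum[OF mods(1) K]])
    fix x y assume "x \<in> carrier ?D" "y \<in> carrier ?D"
    then show "i (fst (x \<oplus>\<^bsub>?D\<^esub> y)) \<oplus>\<^bsub>N\<^esub> snd (x \<oplus>\<^bsub>?D\<^esub> y) =
      i (fst x) \<oplus>\<^bsub>N\<^esub> snd x \<oplus>\<^bsub>N\<^esub> (i (fst y) \<oplus>\<^bsub>N\<^esub> snd y)"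
      by (auto simp: cD) (auto simp: direct_sum_module_def K_def mod_hom_add[OF i] ic Jc N.M.a_ac)
  next
    fix a x assume "a \<in> carrier R" "x \<in> carrier ?D"
    then show "i (fst (a \<odot>\<^bsub>?D\<^esub> x)) \<oplus>\<^bsub>N\<^esub> snd (a \<odot>\<^bsub>?D\<^esub> x) = a \<odot>\<^bsub>N\<^esub> (i (fst x) \<oplus>\<^bsub>N\<^esub> snd x)"
      by (auto simp: cD)
        (auto simp: direct_sum_module_def K_def mod_hom_smult[OF i] ic Jc N.smult_r_distr)
  qed (auto simp: cD ic Jc)
  have "bij_betw f (carrier ?D) (carrier N)"
  proof (rule bij_betw_byWitness[where f' = "\<lambda>y. (p y, y \<ominus>\<^bsub>N\<^esub> i (p y))"])
    have pf: "p (i x \<oplus>\<^bsub>N\<^esub> y) = x" if "x \<in> carrier M" "y \<in> J" for x y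
      using that by (simp add: mod_hom_add[OF p] ic Jc pi)
    have "i x \<oplus>\<^bsub>N\<^esub> y \<ominus>\<^bsub>N\<^esub> i x = y" if "x \<in> carrier M" "y \<in> J" for x y
      using that by (simp add: N.M.a_comm[of "i x"] N.M.add_diff_cancel ic Jc)
    then show "\<forall>z\<in>carrier ?D. (p (f z), f z \<ominus>\<^bsub>N\<^esub> i (p (f z))) = z"
      by (auto simp: f_def cD pf)
    have kJ: "y \<ominus>\<^bsub>N\<^esub> i (p y) \<in> J" if "y \<in> carrier N" for y
      using that mod_hom_closed[OF p that]
      by (simp add: J_def ic mod_hom_diff[OF p] ab pi M.M.diff_zero_iff)
    then show "\<forall>y\<in>carrier N. f (p y, y \<ominus>\<^bsub>N\<^esub> i (p y)) = y"
      using mod_hom_closed[OF p]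
      by (auto simp: f_def cD N.M.a_comm[of "i (p _)"] N.M.diff_add_cancel ic)
    show "f ` carrier ?D \<subseteq> carrier N" using mod_hom_closed[OF f] by auto
    show "(\<lambda>y. (p y, y \<ominus>\<^bsub>N\<^esub> i (p y))) ` carrier N \<subseteq> carrier ?D"
      using kJ mod_hom_closed[OF p] by (auto simp: cD)
  qed
  then show ?thesis
    using mods K f by (auto simp: direct_summand_def mod_isomorphic_def)
qed


section \<open>Free and projective modules\<close>

lemma left_module_free:
  assumes "ring R"
  shows "left_module R (free_module R I)"
proof -
  interpret R: ring R by fact
  have fin: "finite {i \<in> I. f i \<oplus>\<^bsub>R\<^esub> g i \<noteq> \<zero>\<^bsub>R\<^esub>}"
    if "finite {i \<in> I. f i \<noteq> \<zero>\<^bsub>R\<^esub>}" "finite {i \<in> I. g i \<noteq> \<zero>\<^bsub>R\<^esub>}" for f g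
    by (rule finite_subset[OF _ finite_UnI[OF that]]) auto
  have fin_minus: "finite {i \<in> I. \<ominus>\<^bsub>R\<^esub> f i \<noteq> \<zero>\<^bsub>R\<^esub>}"
    if "finite {i \<in> I. f i \<noteq> \<zero>\<^bsub>R\<^esub>}" for f
    by (rule finite_subset[OF _ that]) auto
  have fin_smult: "finite {i \<in> I. a \<otimes>\<^bsub>R\<^esub> f i \<noteq> \<zero>\<^bsub>R\<^esub>}"
    if "finite {i \<in> I. f i \<noteq> \<zero>\<^bsub>R\<^esub>}" "a \<in> carrier R" for f a
    by (rule finite_subset[OF _ that(1)]) (use that in auto)
  let ?F = "free_module R I"
  have restr: "{i \<in> I. (\<lambda>i\<in>I. u i) i \<noteq> \<zero>\<^bsub>R\<^esub>} = {i \<in> I. u i \<noteq> \<zero>\<^bsub>R\<^esub>}" for u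
    by auto
  have mem: "f \<in> carrier ?F \<longleftrightarrow> f \<in> I \<rightarrow>\<^sub>E carrier R \<and> finite {i \<in> I. f i \<noteq> \<zero>\<^bsub>R\<^esub>}" for f
    by (simp add: free_module_def)
  have "abelian_group ?F"
  proof (rule abelian_groupI)
    fix f assume f: "f \<in> carrier ?F"
    then have "(\<lambda>i\<in>I. \<ominus>\<^bsub>R\<^esub> f i) \<in> carrier ?F"
      unfolding mem restr by (auto intro: fin_minus)
    moreover have "(\<lambda>i\<in>I. \<ominus>\<^bsub>R\<^esub> f i) \<oplus>\<^bsub>?F\<^esub> f = \<zero>\<^bsub>?F\<^esub>"
      using f by (auto simp: free_module_def R.l_neg PiE_iff intro!: restrict_ext)
    ultimately show "\<exists>g\<in>carrier ?F. g \<oplus>\<^bsub>?F\<^esub> f = \<zero>\<^bsub>?F\<^esub>" by blast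
  next
    fix f g assume "f \<in> carrier ?F" "g \<in> carrier ?F"
    then have "(\<lambda>i\<in>I. f i \<oplus>\<^bsub>R\<^esub> g i) \<in> carrier ?F"
      using fin[of f g] unfolding mem restr by auto
    then show "f \<oplus>\<^bsub>?F\<^esub> g \<in> carrier ?F" by (simp add: free_module_def)
  qed (auto simp: free_module_def R.a_ac PiE_iff extensional_def)
  moreover have "a \<odot>\<^bsub>?F\<^esub> f \<in> carrier ?F" if "a \<in> carrier R" "f \<in> carrier ?F" for a f
  proof -
    have "(\<lambda>i\<in>I. a \<otimes>\<^bsub>R\<^esub> f i) \<in> carrier ?F"
      using that fin_smult[of f a] unfolding mem restr by auto
    then show ?thesis by (simp add: free_module_def)
  qed
  ultimately show ?thesis
    by (intro left_moduleI)
      (auto simp: assms free_module_def R.l_distr R.r_distr R.m_assoc PiE_iff extensional_def)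
qed

text \<open>For \<open>j\<close> outside \<open>I\<close> this is the zero vector, so it lies in the
  free module for every \<open>j\<close>.\<close>

definition unit_vec :: "('r, 'u) ring_scheme \<Rightarrow> 'i set \<Rightarrow> 'i \<Rightarrow> 'i \<Rightarrow> 'r"
  where "unit_vec R I j = (\<lambda>i\<in>I. if i = j then \<one>\<^bsub>R\<^esub> else \<zero>\<^bsub>R\<^esub>)"

lemma unit_vec_carrier:
  assumes "ring R"
  shows "unit_vec R I j \<in> carrier (free_module R I)"
proof -
  interpret R: ring R by fact
  have "finite {i \<in> I. unit_vec R I j i \<noteq> \<zero>\<^bsub>R\<^esub>}"
    by (rule finite_subset[of _ "{j}"]) (auto simp: unit_vec_def)
  then show ?thesis by (auto simp: free_module_def unit_vec_def)
qed

text \<open>Serves to check congruences between linear maps on basis vectors, as the vectors on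
  which they hold form a submodule. The induction is on a finite set bounding the support and
  removes one coordinate at a time.\<close>

lemma submodule_free_eq_carrier:
  assumes "ring R" "submodule T R (free_module R I)"
    and unit: "\<And>j. j \<in> I \<Longrightarrow> unit_vec R I j \<in> T"
  shows "T = carrier (free_module R I)"
proof -
  interpret R: ring R by fact
  let ?F = "free_module R I"
  interpret F: left_module R ?F by (rule left_module_free) fact
  have "f \<in> carrier ?F \<Longrightarrow> {i \<in> I. f i \<noteq> \<zero>\<^bsub>R\<^esub>} \<subseteq> B \<Longrightarrow> f \<in> T" if "finite B" for B f
    using that
  proof (induction B arbitrary: f rule: finite_induct)
    case empty
    then have "f = \<zero>\<^bsub>?F\<^esub>" by (auto simp: free_module_def PiE_iff extensional_def)
    then show ?case using F.submodule_zero[OF assms(2)] by simp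
  next
    case (insert b B)
    show ?case
    proof (cases "b \<in> I")
      case False
      then show ?thesis using insert by auto
    next
      case True
      define g where "g = (\<lambda>i\<in>I. if i = b then \<zero>\<^bsub>R\<^esub> else f i)"
      have f: "f \<in> I \<rightarrow>\<^sub>E carrier R" "finite {i \<in> I. f i \<noteq> \<zero>\<^bsub>R\<^esub>}"
        using insert.prems(1) by (auto simp: free_module_def)
      have "finite {i \<in> I. g i \<noteq> \<zero>\<^bsub>R\<^esub>}"
        by (rule finite_subset[OF _ f(2)]) (auto simp: g_def)
      then have "g \<in> carrier ?F"
        using f(1) by (auto simp: free_module_def g_def)
      moreover have "{i \<in> I. g i \<noteq> \<zero>\<^bsub>R\<^esub>} \<subseteq> B" using insert.prems(2) by (auto simp: g_def)
      ultimately have "g \<in> T" by (rule insert.IH)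
      moreover have "f b \<odot>\<^bsub>?F\<^esub> unit_vec R I b \<in> T"
        using f(1) True by (intro submodule.smult_closed[OF assms(2)] unit) auto
      moreover have "f = g \<oplus>\<^bsub>?F\<^esub> (f b \<odot>\<^bsub>?F\<^esub> unit_vec R I b)"
      proof
        fix i
        have "f i \<in> carrier R" if "i \<in> I" using f(1) that by auto
        moreover have "f b \<in> carrier R" using f(1) True by auto
        moreover have "f i = undefined" if "i \<notin> I" using f(1) that by auto
        ultimately show "f i = (g \<oplus>\<^bsub>?F\<^esub> (f b \<odot>\<^bsub>?F\<^esub> unit_vec R I b)) i"
          by (auto simp: free_module_def g_def unit_vec_def)
      qed
      ultimately show ?thesis by (metis F.submodule_add[OF assms(2)])
    qed
  qed
  then have "f \<in> T" if "f \<in> carrier ?F" for f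
    using that by (auto simp: free_module_def)
  then show ?thesis using F.submodule_subset[OF assms(2)] by blast
qed

lemma free_module_lift:
  fixes I :: "'i set"
  assumes "left_module R N" and c: "\<And>j. j \<in> I \<Longrightarrow> c j \<in> carrier N"
  shows "\<exists>h\<in>mod_hom R (free_module R I) N. \<forall>j\<in>I. h (unit_vec R I j) = c j"
proof -
  interpret N: left_module R N by fact
  let ?F = "free_module R I"
  interpret F: left_module R ?F by (rule left_module_free[OF N.R.ring_axioms])
  define supp where "supp f = {i \<in> I. f i \<noteq> \<zero>\<^bsub>R\<^esub>}" for f
  define h where "h f = (\<Oplus>\<^bsub>N\<^esub>i\<in>supp f. f i \<odot>\<^bsub>N\<^esub> c i)" for f
  have F: "finite (supp f)" "\<And>i. i \<in> I \<Longrightarrow> f i \<in> carrier R" if "f \<in> carrier ?F" for f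
    using that by (auto simp: free_module_def supp_def)
  \<comment> \<open>The support depends on the vector; summing over a common finite superset makes
    linearity a termwise matter.\<close>
  have h_eq: "h f = (\<Oplus>\<^bsub>N\<^esub>i\<in>B. f i \<odot>\<^bsub>N\<^esub> c i)"
    if "f \<in> carrier ?F" "finite B" "supp f \<subseteq> B" "B \<subseteq> I" for f B
    unfolding h_def using that F(2)[OF that(1)] c
    by (intro N.M.add.finprod_mono_neutral_cong_left) (auto simp: supp_def)
  have cl: "h f \<in> carrier N" if "f \<in> carrier ?F" for f
    unfolding h_def using F[OF that] c by (intro N.M.finsum_closed) (auto simp: supp_def)
  have "(\<lambda>f\<in>carrier ?F. h f) \<in> mod_hom R ?F N"
  proof (rule mod_hom_restrictI)
    fix f g assume fg: "f \<in> carrier ?F" "g \<in> carrier ?F"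
    let ?B = "supp f \<union> supp g"
    have B: "finite ?B" "?B \<subseteq> I" "supp (f \<oplus>\<^bsub>?F\<^esub> g) \<subseteq> ?B"
      using F(1) fg by (auto simp: supp_def free_module_def)
    have "h (f \<oplus>\<^bsub>?F\<^esub> g) = (\<Oplus>\<^bsub>N\<^esub>i\<in>?B. (f \<oplus>\<^bsub>?F\<^esub> g) i \<odot>\<^bsub>N\<^esub> c i)"
      using fg B by (intro h_eq) auto
    also have "\<dots> = (\<Oplus>\<^bsub>N\<^esub>i\<in>?B. f i \<odot>\<^bsub>N\<^esub> c i \<oplus>\<^bsub>N\<^esub> g i \<odot>\<^bsub>N\<^esub> c i)"
      using B F(2) fg c
      by (intro N.M.finsum_cong') (auto simp: free_module_def N.smult_l_distr subset_iff)
    also have "\<dots> = (\<Oplus>\<^bsub>N\<^esub>i\<in>?B. f i \<odot>\<^bsub>N\<^esub> c i) \<oplus>\<^bsub>N\<^esub> (\<Oplus>\<^bsub>N\<^esub>i\<in>?B. g i \<odot>\<^bsub>N\<^esub> c i)"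
      using B(2) F(2) fg c by (intro N.M.finsum_addf) (auto simp: subset_iff)
    also have "\<dots> = h f \<oplus>\<^bsub>N\<^esub> h g"
      using fg B by (simp add: h_eq[of _ ?B])
    finally show "h (f \<oplus>\<^bsub>?F\<^esub> g) = h f \<oplus>\<^bsub>N\<^esub> h g" .
  next
    fix a f assume a: "a \<in> carrier R" and f: "f \<in> carrier ?F"
    have smult_sum: "a \<odot>\<^bsub>N\<^esub> (\<Oplus>\<^bsub>N\<^esub>i\<in>B. u i) = (\<Oplus>\<^bsub>N\<^esub>i\<in>B. a \<odot>\<^bsub>N\<^esub> u i)"
      if "finite B" "u \<in> B \<rightarrow> carrier N" for B :: "'i set" and u
      using that a by (induction B) (auto simp: N.smult_r_distr Pi_def)
    have B: "finite (supp f)" "supp f \<subseteq> I" "supp (a \<odot>\<^bsub>?F\<^esub> f) \<subseteq> supp f"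
      using F(1)[OF f] a by (auto simp: supp_def free_module_def)
    have "h (a \<odot>\<^bsub>?F\<^esub> f) = (\<Oplus>\<^bsub>N\<^esub>i\<in>supp f. (a \<odot>\<^bsub>?F\<^esub> f) i \<odot>\<^bsub>N\<^esub> c i)"
      using f a B by (intro h_eq) auto
    also have "\<dots> = (\<Oplus>\<^bsub>N\<^esub>i\<in>supp f. a \<odot>\<^bsub>N\<^esub> (f i \<odot>\<^bsub>N\<^esub> c i))"
      using B F(2)[OF f] a c
      by (intro N.M.finsum_cong') (auto simp: free_module_def N.smult_assoc1 subset_iff)
    also have "\<dots> = a \<odot>\<^bsub>N\<^esub> h f"
      unfolding h_def using B F(2)[OF f] c by (intro smult_sum[symmetric]) (auto simp: subset_iff)
    finally show "h (a \<odot>\<^bsub>?F\<^esub> f) = a \<odot>\<^bsub>N\<^esub> h f" .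
  qed (use cl F.left_module_axioms in auto)
  moreover have "h (unit_vec R I j) = c j" if j: "j \<in> I" for j
  proof -
    have u: "unit_vec R I j \<in> carrier ?F" by (rule unit_vec_carrier[OF N.R.ring_axioms])
    have "h (unit_vec R I j) = (\<Oplus>\<^bsub>N\<^esub>i\<in>{j}. unit_vec R I j i \<odot>\<^bsub>N\<^esub> c i)"
      using j by (intro h_eq u) (auto simp: supp_def unit_vec_def)
    then show ?thesis using j c by (simp add: unit_vec_def)
  qed
  ultimately show ?thesis
    using unit_vec_carrier[OF N.R.ring_axioms, of I] by (intro bexI[of _ "\<lambda>f\<in>carrier ?F. h f"]) auto
qed

lemma projective_module_left_module: "projective_module R P \<Longrightarrow> left_module R P"
  by (auto simp: projective_module_def direct_summand_def)

text \<open>The lifting property against the map from \<open>N\<close> to the quotient of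
  \<open>L\<close> by \<open>J\<close>, with the quotient expressed by congruences. Writing
  \<open>P\<close> as a retract of a free module reduces it to a choice of one preimage for each
  basis vector.\<close>

lemma projective_lift_modulo:
  assumes "projective_module R P" "left_module R N" "left_module R L" "submodule J R L"
    and g: "g \<in> mod_hom R N L" and f: "f \<in> mod_hom R P L"
    and ex: "\<And>x. x \<in> carrier P \<Longrightarrow> \<exists>y\<in>carrier N. f x \<ominus>\<^bsub>L\<^esub> g y \<in> J"
  shows "\<exists>h\<in>mod_hom R P N. \<forall>x\<in>carrier P. f x \<ominus>\<^bsub>L\<^esub> g (h x) \<in> J"
proof -
  interpret L: left_module R L by fact
  have P: "left_module R P" by (rule projective_module_left_module[OF assms(1)])
  obtain I :: "'c set" where "mod_retract R P (free_module R I)"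
    using assms(1) direct_summand_imp_retract by (auto simp: projective_module_def)
  then obtain i p where i: "i \<in> mod_hom R P (free_module R I)"
    and p: "p \<in> mod_hom R (free_module R I) P" and pi: "\<And>x. x \<in> carrier P \<Longrightarrow> p (i x) = x"
    by (auto simp: mod_retract_def)
  let ?F = "free_module R I"
  have F: "left_module R ?F" by (rule left_module_free[OF L.R.ring_axioms])
  note u = unit_vec_carrier[OF L.R.ring_axioms, of I]
  have "\<forall>j\<in>I. \<exists>y\<in>carrier N. f (p (unit_vec R I j)) \<ominus>\<^bsub>L\<^esub> g y \<in> J"
    using ex mod_hom_closed[OF p u] by blast
  then obtain c where c: "\<And>j. j \<in> I \<Longrightarrow> c j \<in> carrier N"
    "\<And>j. j \<in> I \<Longrightarrow> f (p (unit_vec R I j)) \<ominus>\<^bsub>L\<^esub> g (c j) \<in> J"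
    by metis
  obtain h where h: "h \<in> mod_hom R ?F N" "\<And>j. j \<in> I \<Longrightarrow> h (unit_vec R I j) = c j"
    using free_module_lift[OF assms(2), of I c] c(1) by blast
  \<comment> \<open>The defect of the lift on the free module. It is linear and lies in
    \<open>J\<close> on the basis vectors, hence everywhere; composing with \<open>i\<close> brings
    it back to \<open>P\<close>.\<close>
  define k where "k = (\<lambda>v\<in>carrier ?F. compose (carrier ?F) f p v \<ominus>\<^bsub>L\<^esub> compose (carrier ?F) g h v)"
  have k: "k \<in> mod_hom R ?F L"
    unfolding k_def
    by (intro mod_hom_minus_hom F assms(3) mod_hom_compose[OF F p f] mod_hom_compose[OF F h(1) g])
  have "{v \<in> carrier ?F. k v \<in> J} = carrier ?F"
    using u c(2) h(2)
    by (intro submodule_free_eq_carrier[OF L.R.ring_axioms]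
        submodule_vimage[OF F assms(3) k assms(4)]) (simp add: k_def compose_def)
  then have kJ: "k (i x) \<in> J" if "x \<in> carrier P" for x
    using mod_hom_closed[OF i that] by blast
  have "f x \<ominus>\<^bsub>L\<^esub> g (compose (carrier P) h i x) \<in> J" if "x \<in> carrier P" for x
  proof -
    have "k (i x) = f x \<ominus>\<^bsub>L\<^esub> g (compose (carrier P) h i x)"
      using that mod_hom_closed[OF i that] pi[OF that] by (simp add: k_def compose_def)
    then show ?thesis using kJ[OF that] by simp
  qed
  then show ?thesis
    using mod_hom_compose[OF P i h(1)] by blast
qed

text \<open>Congruence modulo the zero submodule is equality.\<close>

lemma projective_lift:
  assumes "projective_module R P" "left_module R N" "left_module R L"
    and g: "g \<in> mod_hom R N L" and f: "f \<in> mod_hom R P L"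
    and ex: "\<And>x. x \<in> carrier P \<Longrightarrow> f x \<in> g ` carrier N"
  shows "\<exists>h\<in>mod_hom R P N. \<forall>x\<in>carrier P. g (h x) = f x"
proof -
  interpret L: left_module R L by fact
  have diff: "f x \<ominus>\<^bsub>L\<^esub> g y \<in> {\<zero>\<^bsub>L\<^esub>} \<longleftrightarrow> g y = f x" if "x \<in> carrier P" "y \<in> carrier N" for x y
    using that by (auto simp: L.M.diff_zero_iff mod_hom_closed[OF f] mod_hom_closed[OF g])
  have "\<exists>h\<in>mod_hom R P N. \<forall>x\<in>carrier P. f x \<ominus>\<^bsub>L\<^esub> g (h x) \<in> {\<zero>\<^bsub>L\<^esub>}"
  proof (rule projective_lift_modulo[OF assms(1-3) L.submodule_singleton_zero g f])
    fix x assume "x \<in> carrier P"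
    with ex diff show "\<exists>y\<in>carrier N. f x \<ominus>\<^bsub>L\<^esub> g y \<in> {\<zero>\<^bsub>L\<^esub>}" by (metis imageE)
  qed
  then show ?thesis using diff mod_hom_closed by metis
qed


section \<open>Endomorphism rings and Hom modules\<close>

text \<open>\<open>End_ring R Q\<close> and \<open>Hom_module R Q Q\<close> are records of different
  types with the same additive data; this carries the group axioms from one to the other.\<close>

lemma abelian_group_cong:
  assumes "abelian_group G" "carrier H = carrier G" "\<zero>\<^bsub>H\<^esub> = \<zero>\<^bsub>G\<^esub>" "(\<oplus>\<^bsub>H\<^esub>) = (\<oplus>\<^bsub>G\<^esub>)"
  shows "abelian_group H"
proof -
  interpret G: abelian_group G by fact
  show ?thesis
  proof (rule abelian_groupI)
    fix x assume "x \<in> carrier H"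
    then show "\<exists>y\<in>carrier H. y \<oplus>\<^bsub>H\<^esub> x = \<zero>\<^bsub>H\<^esub>"
      by (intro bexI[of _ "\<ominus>\<^bsub>G\<^esub> x"]) (auto simp: assms G.l_neg)
  qed (auto simp: assms G.a_ac)
qed

lemma Hom_module_abelian_group:
  assumes "left_module R M" "left_module R Q"
  shows "abelian_group (Hom_module R M Q)"
proof -
  interpret Q: left_module R Q by fact
  let ?H = "Hom_module R M Q"
  note mem = mod_hom_closed[of _ R M Q] and ext = mod_hom_extensional[of _ R M Q]
  show ?thesis
  proof (rule abelian_groupI)
    fix f g assume "f \<in> carrier ?H" "g \<in> carrier ?H"
    then show "f \<oplus>\<^bsub>?H\<^esub> g \<in> carrier ?H" "f \<oplus>\<^bsub>?H\<^esub> g = g \<oplus>\<^bsub>?H\<^esub> f"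
      by (auto simp: Hom_module_def mod_hom_plus[OF assms] Q.M.a_comm mem intro!: restrict_ext)
  next
    fix f assume f: "f \<in> carrier ?H"
    show "\<zero>\<^bsub>?H\<^esub> \<oplus>\<^bsub>?H\<^esub> f = f"
      using f ext[of f] mem[of f]
      by (auto simp: Hom_module_def zero_hom_def extensional_def)
    show "\<exists>g\<in>carrier ?H. g \<oplus>\<^bsub>?H\<^esub> f = \<zero>\<^bsub>?H\<^esub>"
      using f mod_hom_uminus[OF assms, of f] mem[of f]
      by (intro bexI[of _ "\<lambda>x\<in>carrier M. \<ominus>\<^bsub>Q\<^esub> f x"])
        (auto simp: Hom_module_def zero_hom_def Q.M.l_neg intro!: restrict_ext)
  qed (auto simp: Hom_module_def mod_hom_zero_hom[OF assms] Q.M.a_assoc mem intro!: restrict_ext)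
qed

lemma End_ring_ring:
  assumes "left_module R Q"
  shows "ring (End_ring R Q)"
proof (rule ringI)
  interpret Q: left_module R Q by fact
  let ?S = "End_ring R Q"
  note mem = mod_hom_closed[of _ R Q Q] and ext = mod_hom_extensional[of _ R Q Q]
    and add = mod_hom_add[of _ R Q Q]
  show "abelian_group ?S"
    by (rule abelian_group_cong[OF Hom_module_abelian_group[OF assms assms]])
      (simp_all add: End_ring_def Hom_module_def)
  show "Group.monoid ?S"
  proof (rule monoidI)
    fix f g h assume "f \<in> carrier ?S" "g \<in> carrier ?S" "h \<in> carrier ?S"
    then show "f \<otimes>\<^bsub>?S\<^esub> g \<otimes>\<^bsub>?S\<^esub> h = f \<otimes>\<^bsub>?S\<^esub> (g \<otimes>\<^bsub>?S\<^esub> h)"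
      by (auto simp: End_ring_def compose_def mem intro!: restrict_ext)
  next
    fix f assume "f \<in> carrier ?S"
    then show "\<one>\<^bsub>?S\<^esub> \<otimes>\<^bsub>?S\<^esub> f = f" "f \<otimes>\<^bsub>?S\<^esub> \<one>\<^bsub>?S\<^esub> = f"
      using ext[of f] by (auto simp: End_ring_def compose_def mem extensional_def)
  qed (auto simp: End_ring_def mod_hom_id[OF assms] mod_hom_compose[OF assms])
  fix f g h assume "f \<in> carrier ?S" "g \<in> carrier ?S" "h \<in> carrier ?S"
  then show "(f \<oplus>\<^bsub>?S\<^esub> g) \<otimes>\<^bsub>?S\<^esub> h = f \<otimes>\<^bsub>?S\<^esub> h \<oplus>\<^bsub>?S\<^esub> g \<otimes>\<^bsub>?S\<^esub> h"
    "h \<otimes>\<^bsub>?S\<^esub> (f \<oplus>\<^bsub>?S\<^esub> g) = h \<otimes>\<^bsub>?S\<^esub> f \<oplus>\<^bsub>?S\<^esub> h \<otimes>\<^bsub>?S\<^esub> g"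
    by (auto simp: End_ring_def compose_def mem add intro!: restrict_ext)
qed

lemma Hom_module_left_module:
  assumes "left_module R M" "left_module R Q"
  shows "left_module (End_ring R Q) (Hom_module R M Q)"
proof -
  note mem = mod_hom_closed[of _ R M Q] and ext = mod_hom_extensional[of _ R M Q]
    and add = mod_hom_add[of _ R Q Q]
  show ?thesis
  proof (rule left_moduleI[OF End_ring_ring[OF assms(2)] Hom_module_abelian_group[OF assms]])
    fix f assume "f \<in> carrier (Hom_module R M Q)"
    then show "\<one>\<^bsub>End_ring R Q\<^esub> \<odot>\<^bsub>Hom_module R M Q\<^esub> f = f"
      using ext[of f] mem[of f]
      by (auto simp: Hom_module_def End_ring_def compose_def extensional_def)
  qed (auto simp: Hom_module_def End_ring_def compose_def mem add
      mod_hom_compose[OF assms(1), unfolded compose_def] intro!: restrict_ext)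
qed

lemma Hom_module_precompose:
  assumes "left_module R M" "left_module R N" "left_module R Q" and g: "g \<in> mod_hom R M N"
  shows "(\<lambda>f\<in>mod_hom R N Q. compose (carrier M) f g)
    \<in> mod_hom (End_ring R Q) (Hom_module R N Q) (Hom_module R M Q)"
proof -
  have "(\<lambda>f\<in>carrier (Hom_module R N Q). compose (carrier M) f g)
    \<in> mod_hom (End_ring R Q) (Hom_module R N Q) (Hom_module R M Q)"
  proof (rule mod_hom_restrictI[OF Hom_module_left_module[OF assms(2,3)]])
    fix f assume "f \<in> carrier (Hom_module R N Q)"
    then show "compose (carrier M) f g \<in> carrier (Hom_module R M Q)"
      using mod_hom_compose[OF assms(1) g] by (simp add: Hom_module_def)
  qed (auto simp: Hom_module_def End_ring_def compose_def mod_hom_closed[OF g] intro!: restrict_ext)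
  then show ?thesis by (simp add: Hom_module_def)
qed

text \<open>The inclusion \<open>i\<close> generates: any f equals the scalar \<open>f\<close> after
  \<open>p\<close> applied to \<open>i\<close>, since \<open>p\<close> after \<open>i\<close> is the
  identity.\<close>

lemma Hom_module_finitely_generated:
  assumes M: "left_module R M" and Q: "left_module R Q" and "mod_retract R M Q"
  shows "finitely_generated_module (End_ring R Q) (Hom_module R M Q)"
proof -
  obtain i p where i: "i \<in> mod_hom R M Q" and p: "p \<in> mod_hom R Q M"
    and pi: "\<And>x. x \<in> carrier M \<Longrightarrow> p (i x) = x"
    using assms(3) by (auto simp: mod_retract_def)
  interpret H: left_module "End_ring R Q" "Hom_module R M Q"
    by (rule Hom_module_left_module[OF M Q])
  have "\<exists>c\<in>{i} \<rightarrow> carrier (End_ring R Q).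
      f = (\<Oplus>\<^bsub>Hom_module R M Q\<^esub>x\<in>{i}. c x \<odot>\<^bsub>Hom_module R M Q\<^esub> x)"
    if f: "f \<in> carrier (Hom_module R M Q)" for f
  proof -
    have f': "f \<in> mod_hom R M Q" using f by (simp add: Hom_module_def)
    have s: "compose (carrier Q) f p \<in> carrier (End_ring R Q)"
      using mod_hom_compose[OF Q p f'] by (simp add: End_ring_def)
    have i': "i \<in> carrier (Hom_module R M Q)" using i by (simp add: Hom_module_def)
    have "compose (carrier Q) f p \<odot>\<^bsub>Hom_module R M Q\<^esub> i = f"
      using mod_hom_extensional[OF f'] pi mod_hom_closed[OF i]
      by (auto simp: Hom_module_def compose_def extensional_def)
    then show ?thesis
      using s i' H.smult_closed[OF s i'] by (intro bexI[of _ "\<lambda>_. compose (carrier Q) f p"]) auto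
  qed
  then show ?thesis
    unfolding finitely_generated_module_def using i
    by (intro conjI H.left_module_axioms exI[of _ "{i}"]) (auto simp: Hom_module_def)
qed

text \<open>Precomposition with \<open>p\<close> and with \<open>i\<close> exhibits the Hom module
  as a retract of Hom(Q, Q), the free module of rank one over the endomorphism ring.\<close>

lemma Hom_module_projective:
  fixes M :: "('r, 'm, 'v) module_scheme" and Q :: "('r, 'p, 'w) module_scheme"
  assumes M: "left_module R M" and Q: "left_module R Q" and "mod_retract R M Q"
  shows "projective_module (End_ring R Q) (Hom_module R M Q)"
proof -
  obtain i p where i: "i \<in> mod_hom R M Q" and p: "p \<in> mod_hom R Q M"
    and pi: "\<And>x. x \<in> carrier M \<Longrightarrow> p (i x) = x"
    using assms(3) by (auto simp: mod_retract_def)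
  let ?S = "End_ring R Q" and ?H = "Hom_module R M Q"
  \<comment> \<open>\<open>projective_module\<close> takes the basis from the element type of the
    module, here a function type. Rank one needs a single label, and any element of the type would
    do.\<close>
  let ?b = "undefined :: 'm \<Rightarrow> 'p"
  let ?F = "free_module ?S {?b}"
  have S: "ring ?S" by (rule End_ring_ring[OF Q])
  have H: "left_module ?S ?H" by (rule Hom_module_left_module[OF M Q])
  have F: "left_module ?S ?F" by (rule left_module_free[OF S])
  define I where "I = (\<lambda>f\<in>carrier ?H. \<lambda>b\<in>{?b}. compose (carrier Q) f p)"
  define P where "P = (\<lambda>v\<in>carrier ?F. compose (carrier M) (v ?b) i)"
  have I: "I \<in> mod_hom ?S ?H ?F"
    unfolding I_def
  proof (rule mod_hom_restrictI[OF H])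
    fix f assume "f \<in> carrier ?H"
    then show "(\<lambda>b\<in>{?b}. compose (carrier Q) f p) \<in> carrier ?F"
      using mod_hom_compose[OF Q p] by (auto simp: free_module_def End_ring_def Hom_module_def)
  qed (auto simp: free_module_def End_ring_def Hom_module_def compose_def mod_hom_closed[OF p]
      intro!: restrict_ext)
  have P: "P \<in> mod_hom ?S ?F ?H"
    unfolding P_def
  proof (rule mod_hom_restrictI[OF F])
    fix v assume "v \<in> carrier ?F"
    then show "compose (carrier M) (v ?b) i \<in> carrier ?H"
      using mod_hom_compose[OF M i] by (auto simp: free_module_def End_ring_def Hom_module_def)
  qed (auto simp: free_module_def End_ring_def Hom_module_def compose_def mod_hom_closed[OF i]
      intro!: restrict_ext)
  have PI: "P (I f) = f" if "f \<in> carrier ?H" for f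
  proof -
    have "I f \<in> carrier ?F" using I that by (rule mod_hom_closed)
    then have "P (I f) = compose (carrier M) (compose (carrier Q) f p) i"
      using that by (simp add: P_def) (simp add: I_def)
    also have "\<dots> = f"
    proof (rule extensionalityI[where A = "carrier M"])
      show "f \<in> extensional (carrier M)"
        using that by (simp add: Hom_module_def mod_hom_extensional)
    qed (use mod_hom_closed[OF i] pi in \<open>auto simp: compose_def\<close>)
    finally show ?thesis .
  qed
  have "mod_retract ?S ?H ?F"
    unfolding mod_retract_def by (intro bexI[OF _ I] bexI[OF _ P] ballI PI)
  then show ?thesis
    unfolding projective_module_def using retract_imp_direct_summand[OF H F] by blast
qed


section \<open>Regular sequences and the vanishing of Ext\<close>

text \<open>Membership hands over an explicit multiple of the head element with a remainder in the
  tail's submodule. This is what division by the head modulo the tail requires.\<close>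

primrec seq_submodule :: "('r, 'm, 'v) module_scheme \<Rightarrow> 'r list \<Rightarrow> 'm set"
  where "seq_submodule M [] = {\<zero>\<^bsub>M\<^esub>}"
  | "seq_submodule M (a # as) = {a \<odot>\<^bsub>M\<^esub> x \<oplus>\<^bsub>M\<^esub> y | x y. x \<in> carrier M \<and> y \<in> seq_submodule M as}"

text \<open>In contrast to the usual convention, the first element of a sequence is required to be regular
  modulo the later ones, and \<open>M\<close> may equal \<^term>\<open>seq_submodule M as\<close>.\<close>

primrec regular_seq :: "('r, 'm, 'v) module_scheme \<Rightarrow> 'r list \<Rightarrow> bool"
  where "regular_seq M [] \<longleftrightarrow> True"
  | "regular_seq M (a # as) \<longleftrightarrow> regular_seq M as \<and>
      (\<forall>x\<in>carrier M. a \<odot>\<^bsub>M\<^esub> x \<in> seq_submodule M as \<longrightarrow> x \<in> seq_submodule M as)"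

text \<open>Since regularity is tested modulo later elements, suffixes stay regular. The induction
  can therefore move elements from the end of one list to the front of the next without changing the
  concatenation.\<close>

lemma regular_seq_append: "regular_seq M (as @ bs) \<Longrightarrow> regular_seq M bs"
  by (induction as) auto

lemma submodule_seq_submodule:
  assumes "cring R" "left_module R M" "set as \<subseteq> carrier R"
  shows "submodule (seq_submodule M as) R M"
  using assms(3)
proof (induction as)
  interpret R: cring R by fact
  interpret M: left_module R M by fact
  case Nil
  then show ?case by (simp add: M.submodule_singleton_zero)
next
  interpret R: cring R by fact
  interpret M: left_module R M by fact
  case (Cons a as)
  then have J: "submodule (seq_submodule M as) R M" and a: "a \<in> carrier R" by auto
  note Jc = subsetD[OF M.submodule_subset[OF J]]
  show ?case
  proof (rule M.submoduleI)
    show "seq_submodule M (a # as) \<subseteq> carrier M" using a Jc by auto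
    show "\<zero>\<^bsub>M\<^esub> \<in> seq_submodule M (a # as)"
      using a M.submodule_zero[OF J] by (auto intro!: exI[of _ "\<zero>\<^bsub>M\<^esub>"])
  next
    fix v assume "v \<in> seq_submodule M (a # as)"
    then obtain x y where v: "v = a \<odot>\<^bsub>M\<^esub> x \<oplus>\<^bsub>M\<^esub> y" "x \<in> carrier M" "y \<in> seq_submodule M as"
      by auto
    have "\<ominus>\<^bsub>M\<^esub> v = a \<odot>\<^bsub>M\<^esub> (\<ominus>\<^bsub>M\<^esub> x) \<oplus>\<^bsub>M\<^esub> (\<ominus>\<^bsub>M\<^esub> y)"
      using v a Jc by (simp add: M.M.minus_add M.smult_r_minus)
    then show "\<ominus>\<^bsub>M\<^esub> v \<in> seq_submodule M (a # as)"
      using v M.submodule_minus[OF J] by auto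
    fix w assume "w \<in> seq_submodule M (a # as)"
    then obtain x' y' where w: "w = a \<odot>\<^bsub>M\<^esub> x' \<oplus>\<^bsub>M\<^esub> y'" "x' \<in> carrier M" "y' \<in> seq_submodule M as"
      by auto
    have "v \<oplus>\<^bsub>M\<^esub> w = a \<odot>\<^bsub>M\<^esub> (x \<oplus>\<^bsub>M\<^esub> x') \<oplus>\<^bsub>M\<^esub> (y \<oplus>\<^bsub>M\<^esub> y')"
      using v w a Jc by (simp add: M.smult_r_distr M.M.a_ac)
    then show "v \<oplus>\<^bsub>M\<^esub> w \<in> seq_submodule M (a # as)"
      using v w M.submodule_add[OF J] by auto
  next
    fix b v assume b: "b \<in> carrier R" and "v \<in> seq_submodule M (a # as)"
    then obtain x y where v: "v = a \<odot>\<^bsub>M\<^esub> x \<oplus>\<^bsub>M\<^esub> y" "x \<in> carrier M" "y \<in> seq_submodule M as"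
      by auto
    have "b \<odot>\<^bsub>M\<^esub> v = a \<odot>\<^bsub>M\<^esub> (b \<odot>\<^bsub>M\<^esub> x) \<oplus>\<^bsub>M\<^esub> b \<odot>\<^bsub>M\<^esub> y"
      using v a b Jc by (simp add: M.smult_r_distr M.smult_assoc1[symmetric] R.m_comm)
    then show "b \<odot>\<^bsub>M\<^esub> v \<in> seq_submodule M (a # as)"
      using v b submodule.smult_closed[OF J] by auto
  qed
qed

lemma mod_hom_seq_submodule:
  assumes "cring R" "left_module R M" "left_module R N" "f \<in> mod_hom R M N" "set as \<subseteq> carrier R"
    and "v \<in> seq_submodule M as"
  shows "f v \<in> seq_submodule N as"
  using assms(5,6)
proof (induction as arbitrary: v)
  case Nil
  then show ?case using assms by (simp add: mod_hom_zero left_module_abelian_group)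
next
  interpret M: left_module R M by fact
  case (Cons a as)
  then obtain x y where v: "v = a \<odot>\<^bsub>M\<^esub> x \<oplus>\<^bsub>M\<^esub> y" "x \<in> carrier M" "y \<in> seq_submodule M as"
    by auto
  have "y \<in> carrier M"
    using v M.submodule_subset[OF submodule_seq_submodule[OF assms(1,2), of as]] Cons.prems by auto
  then have "f v = a \<odot>\<^bsub>N\<^esub> f x \<oplus>\<^bsub>N\<^esub> f y"
    using v Cons.prems by (simp add: mod_hom_add[OF assms(4)] mod_hom_smult[OF assms(4)])
  then show ?case
    using Cons.IH[OF _ v(3)] Cons.prems mod_hom_closed[OF assms(4) v(2)] by auto
qed

text \<open>Linear maps carry the submodule of a sequence into that of the target. So
  \<open>i\<close> takes the question from \<open>M\<close> to \<open>N\<close>, where regularity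
  applies, and \<open>p\<close> brings the answer back.\<close>

lemma regular_seq_retract:
  assumes "cring R" and M: "left_module R M" and N: "left_module R N" and "mod_retract R M N"
    and "set as \<subseteq> carrier R" "regular_seq N as"
  shows "regular_seq M as"
  using assms(5,6)
proof (induction as)
  obtain i p where i: "i \<in> mod_hom R M N" and p: "p \<in> mod_hom R N M"
    and pi: "\<And>x. x \<in> carrier M \<Longrightarrow> p (i x) = x"
    using assms(4) unfolding mod_retract_def by blast
  case (Cons a as)
  have "x \<in> seq_submodule M as" if x: "x \<in> carrier M" "a \<odot>\<^bsub>M\<^esub> x \<in> seq_submodule M as" for x
  proof -
    have "a \<odot>\<^bsub>N\<^esub> i x \<in> seq_submodule N as"
      using mod_hom_seq_submodule[OF assms(1) M N i _ x(2)] x(1) Cons.prems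
      by (simp add: mod_hom_smult[OF i])
    then have "i x \<in> seq_submodule N as" using Cons.prems mod_hom_closed[OF i x(1)] by simp
    then have "p (i x) \<in> seq_submodule M as"
      using Cons.prems by (intro mod_hom_seq_submodule[OF assms(1) N M p]) auto
    then show ?thesis using pi x by simp
  qed
  then show ?case using Cons by simp
qed simp

section \<open>Null-homotopies on a projective resolution\<close>

locale cring_resolution = cring R
  for R :: "('r, 'u) ring_scheme" (structure) +
  fixes P :: "nat \<Rightarrow> ('r, 'm) module" and d :: "nat \<Rightarrow> 'm \<Rightarrow> 'm" and \<epsilon> :: "'m \<Rightarrow> 'n"
    and M :: "('r, 'n) module"
  assumes resolution: "projective_resolution R P d \<epsilon> M"
begin

lemma projective: "projective_module R (P n)"
  and d_hom: "d n \<in> mod_hom R (P (Suc n)) (P n)"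
  and eps_hom: "\<epsilon> \<in> mod_hom R (P 0) M"
  and eps_surj: "\<epsilon> ` carrier (P 0) = carrier M"
  and M_module: "left_module R M"
  and kernel_0: "{x \<in> carrier (P 0). \<epsilon> x = \<zero>\<^bsub>M\<^esub>} = d 0 ` carrier (P 1)"
  and kernel_Suc: "{x \<in> carrier (P (Suc n)). d n x = \<zero>\<^bsub>P n\<^esub>} = d (Suc n) ` carrier (P (Suc (Suc n)))"
  using resolution unfolding projective_resolution_def
  by - (elim conjE, assumption | elim conjE, drule spec, assumption)+

lemma P_module: "left_module R (P n)"
  by (rule projective_module_left_module[OF projective])

lemma P_abelian_group: "abelian_group (P n)"
  by (rule left_module_abelian_group[OF P_module])

lemma d_d: "x \<in> carrier (P (Suc (Suc n))) \<Longrightarrow> d n (d (Suc n) x) = \<zero>\<^bsub>P n\<^esub>"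
  using kernel_Suc[of n] by blast

text \<open>The identity \<open>d h + h d = a\<close> solved for \<open>d h\<close>, the form in
  which each component arises as a lift. In degree zero there is no term \<open>h d\<close>.\<close>

definition homothety_homotopy :: "'r \<Rightarrow> (nat \<Rightarrow> 'm \<Rightarrow> 'm) \<Rightarrow> bool"
  where "homothety_homotopy a h \<longleftrightarrow>
    (\<forall>n. h n \<in> mod_hom R (P n) (P (Suc n))) \<and>
    (\<forall>x\<in>carrier (P 0). d 0 (h 0 x) = a \<odot>\<^bsub>P 0\<^esub> x) \<and>
    (\<forall>n. \<forall>x\<in>carrier (P (Suc n)).
      d (Suc n) (h (Suc n) x) = a \<odot>\<^bsub>P (Suc n)\<^esub> x \<ominus>\<^bsub>P (Suc n)\<^esub> h n (d n x))"

text \<open>An instance of the comparison theorem: multiplication by \<open>a\<close> and the zero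
  map both cover the zero endomorphism of \<open>M\<close>, so they are homotopic.\<close>

lemma annihilator_null_homotopy:
  assumes a: "a \<in> carrier R" and ann: "\<And>x. x \<in> carrier M \<Longrightarrow> a \<odot>\<^bsub>M\<^esub> x = \<zero>\<^bsub>M\<^esub>"
  shows "\<exists>h. homothety_homotopy a h"
proof -
  note mult_a = mod_hom_homothety[OF is_cring P_module a]
  \<comment> \<open>The last clause, \<open>d h d = a d\<close>, is the invariant that keeps the
    recursion going: it puts \<open>a - h d\<close> into the kernel of \<open>d n\<close>, which by
    exactness is the image of the next differential. The identity linking consecutive components is
    kept apart in \<open>next_hom\<close>, as dependent choice demands.\<close>
  define good where "good n h \<longleftrightarrow> h \<in> mod_hom R (P n) (P (Suc n)) \<and>
    (n = 0 \<longrightarrow> (\<forall>x\<in>carrier (P 0). d 0 (h x) = a \<odot>\<^bsub>P 0\<^esub> x)) \<and>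
    (\<forall>y\<in>carrier (P (Suc n)). d n (h (d n y)) = a \<odot>\<^bsub>P n\<^esub> d n y)" for n h
  define next_hom where "next_hom n h h' \<longleftrightarrow> (\<forall>x\<in>carrier (P (Suc n)).
    d (Suc n) (h' x) = a \<odot>\<^bsub>P (Suc n)\<^esub> x \<ominus>\<^bsub>P (Suc n)\<^esub> h (d n x))" for n h h'
  have "\<exists>h. \<forall>n. good n (h n) \<and> next_hom n (h n) (h (Suc n))"
  proof (rule dependent_nat_choice)
    interpret P0: left_module R "P 0" by (rule P_module)
    interpret M: left_module R M by (rule M_module)
    have "\<exists>h\<in>mod_hom R (P 0) (P 1). \<forall>x\<in>carrier (P 0). d 0 (h x) = (\<lambda>x\<in>carrier (P 0). a \<odot>\<^bsub>P 0\<^esub> x) x"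
    proof (rule projective_lift[OF projective P_module P_module _ mult_a])
      show "d 0 \<in> mod_hom R (P 1) (P 0)" using d_hom[of 0] by simp
      fix x assume x: "x \<in> carrier (P 0)"
      have "\<epsilon> (a \<odot>\<^bsub>P 0\<^esub> x) = \<zero>\<^bsub>M\<^esub>"
        using x a ann mod_hom_closed[OF eps_hom] by (simp add: mod_hom_smult[OF eps_hom])
      then show "(\<lambda>x\<in>carrier (P 0). a \<odot>\<^bsub>P 0\<^esub> x) x \<in> d 0 ` carrier (P 1)"
        using x a unfolding kernel_0[symmetric] by simp
    qed
    then show "\<exists>h. good 0 h"
      unfolding good_def using mod_hom_closed[OF d_hom[of 0]] by auto
  next
    fix h n assume "good n h"
    then have h: "h \<in> mod_hom R (P n) (P (Suc n))"
      and hd: "\<And>y. y \<in> carrier (P (Suc n)) \<Longrightarrow> d n (h (d n y)) = a \<odot>\<^bsub>P n\<^esub> d n y"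
      by (auto simp: good_def)
    interpret Pn: left_module R "P n" by (rule P_module)
    interpret PSn: left_module R "P (Suc n)" by (rule P_module)
    let ?c = "carrier (P (Suc n))"
    define f where "f = (\<lambda>x\<in>?c. (\<lambda>x\<in>?c. a \<odot>\<^bsub>P (Suc n)\<^esub> x) x \<ominus>\<^bsub>P (Suc n)\<^esub> compose ?c h (d n) x)"
    have f: "f \<in> mod_hom R (P (Suc n)) (P (Suc n))"
      unfolding f_def
      by (intro mod_hom_minus_hom P_module mult_a mod_hom_compose[OF P_module d_hom h])
    have f_eq: "f x = a \<odot>\<^bsub>P (Suc n)\<^esub> x \<ominus>\<^bsub>P (Suc n)\<^esub> h (d n x)" if "x \<in> ?c" for x
      using that by (simp add: f_def compose_def)
    have hc: "h (d n x) \<in> ?c" if "x \<in> ?c" for x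
      using that mod_hom_closed[OF d_hom[of n]] mod_hom_closed[OF h] by blast
    have "\<exists>h'\<in>mod_hom R (P (Suc n)) (P (Suc (Suc n))). \<forall>x\<in>?c. d (Suc n) (h' x) = f x"
    proof (rule projective_lift[OF projective P_module P_module d_hom f])
      fix x assume x: "x \<in> ?c"
      have "d n (f x) = \<zero>\<^bsub>P n\<^esub>"
        using x a hc[OF x] hd[OF x] mod_hom_closed[OF d_hom x]
        by (simp add: f_eq mod_hom_diff[OF d_hom] P_abelian_group mod_hom_smult[OF d_hom]
            Pn.M.diff_zero_iff)
      then show "f x \<in> d (Suc n) ` carrier (P (Suc (Suc n)))"
        using mod_hom_closed[OF f x] unfolding kernel_Suc[symmetric] by simp
    qed
    then obtain h' where h': "h' \<in> mod_hom R (P (Suc n)) (P (Suc (Suc n)))"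
      and dh': "\<And>x. x \<in> ?c \<Longrightarrow> d (Suc n) (h' x) = f x" by blast
    \<comment> \<open>The invariant renews itself, because the correction term contains two
      consecutive differentials.\<close>
    have "d (Suc n) (h' (d (Suc n) y)) = a \<odot>\<^bsub>P (Suc n)\<^esub> d (Suc n) y"
      if "y \<in> carrier (P (Suc (Suc n)))" for y
      using that a mod_hom_closed[OF d_hom that]
      by (simp add: dh' f_eq d_d mod_hom_zero[OF h P_abelian_group P_abelian_group])
    then show "\<exists>h'. good (Suc n) h' \<and> next_hom n h h'"
      using h' by (intro exI[of _ h']) (auto simp: good_def next_hom_def dh' f_eq)
  qed
  then obtain h where "\<And>n. good n (h n)" "\<And>n. next_hom n (h n) (h (Suc n))" by blast
  then show ?thesis
    by (intro exI[of _ h]) (auto simp: homothety_homotopy_def good_def next_hom_def)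
qed

section \<open>Rees's argument with a fixed coefficient module\<close>

context
  fixes Q :: "('r, 'q, 'w) module_scheme"
  assumes Q: "left_module R Q"
begin

text \<open>The homotopy writes \<open>a x\<close> as a boundary, so the cocycle condition puts
  \<open>a f(x)\<close> into the submodule; regularity then cancels \<open>a\<close>.\<close>

lemma cocycle_0_modulo:
  assumes a: "a \<in> carrier R" and ann: "\<And>x. x \<in> carrier M \<Longrightarrow> a \<odot>\<^bsub>M\<^esub> x = \<zero>\<^bsub>M\<^esub>"
    and reg: "regular_seq Q (a # bs)"
    and f: "f \<in> mod_hom R (P 0) Q"
    and cocycle: "\<And>y. y \<in> carrier (P 1) \<Longrightarrow> f (d 0 y) \<in> seq_submodule Q bs"
    and x: "x \<in> carrier (P 0)"
  shows "f x \<in> seq_submodule Q bs"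
proof -
  obtain h where "homothety_homotopy a h"
    using annihilator_null_homotopy[OF a ann] ..
  then have h: "h 0 \<in> mod_hom R (P 0) (P (Suc 0))" and dh: "d 0 (h 0 x) = a \<odot>\<^bsub>P 0\<^esub> x"
    using x by (simp_all add: homothety_homotopy_def)
  have "a \<odot>\<^bsub>Q\<^esub> f x = f (d 0 (h 0 x))"
    unfolding dh by (rule mod_hom_smult[OF f a x, symmetric])
  also have "\<dots> \<in> seq_submodule Q bs"
    using cocycle mod_hom_closed[OF h x] by simp
  finally show ?thesis
    using reg mod_hom_closed[OF f x] by simp
qed

text \<open>Stands in for the long exact sequence of 0 \<rightarrow> Q/J \<rightarrow> Q/J
  \<rightarrow> Q/(aQ + J) \<rightarrow> 0, whose first map is multiplication by \<open>a\<close>.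
  Since \<open>a\<close> kills Ext, a class in degree n + 1 comes from degree n with coefficients in
  the last term, where \<open>IH\<close> applies. \<open>IH\<close> is a premise so that both the
  induction and the final vanishing result can use this step.\<close>

lemma cocycle_Suc_modulo:
  assumes a: "a \<in> carrier R" and ann: "\<And>x. x \<in> carrier M \<Longrightarrow> a \<odot>\<^bsub>M\<^esub> x = \<zero>\<^bsub>M\<^esub>"
    and bs: "set bs \<subseteq> carrier R" and reg: "regular_seq Q (a # bs)"
    and IH: "\<And>g. \<lbrakk>g \<in> mod_hom R (P n) Q;
        \<And>y. y \<in> carrier (P (Suc n)) \<Longrightarrow> g (d n y) \<in> seq_submodule Q (a # bs)\<rbrakk> \<Longrightarrow>
      \<exists>w\<in>mod_hom R (P n) Q. (\<forall>x\<in>carrier (P n). w x \<in> seq_submodule Q (a # bs)) \<and>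
        (\<forall>y\<in>carrier (P (Suc n)). w (d n y) = g (d n y))"
    and f: "f \<in> mod_hom R (P (Suc n)) Q"
    and cocycle: "\<And>y. y \<in> carrier (P (Suc (Suc n))) \<Longrightarrow> f (d (Suc n) y) \<in> seq_submodule Q bs"
  shows "\<exists>u\<in>mod_hom R (P n) Q. \<forall>x\<in>carrier (P (Suc n)). f x \<ominus>\<^bsub>Q\<^esub> u (d n x) \<in> seq_submodule Q bs"
proof -
  interpret Q: left_module R Q by (rule Q)
  interpret PSn: left_module R "P (Suc n)" by (rule P_module)
  have J: "submodule (seq_submodule Q bs) R Q"
    by (rule submodule_seq_submodule[OF is_cring Q bs])
  obtain h where "homothety_homotopy a h"
    using annihilator_null_homotopy[OF a ann] ..
  then have h: "\<And>n. h n \<in> mod_hom R (P n) (P (Suc n))"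
    and dh: "\<And>x. x \<in> carrier (P (Suc n)) \<Longrightarrow>
      d (Suc n) (h (Suc n) x) = a \<odot>\<^bsub>P (Suc n)\<^esub> x \<ominus>\<^bsub>P (Suc n)\<^esub> h n (d n x)"
    by (simp_all add: homothety_homotopy_def)
  note dc = mod_hom_closed[OF d_hom] and hc = mod_hom_closed[OF h] and fc = mod_hom_closed[OF f]
  \<comment> \<open>\<open>g\<close> bounds \<open>a f\<close> modulo \<open>bs\<close>: by the
    homotopy identity, \<open>a f - g d\<close> is \<open>f\<close> applied to a boundary.
    Consequently \<open>g\<close> is a cocycle modulo \<open>a # bs\<close>.\<close>
  define g where "g = compose (carrier (P n)) f (h n)"
  have g: "g \<in> mod_hom R (P n) Q"
    unfolding g_def by (rule mod_hom_compose[OF P_module h f])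
  note gc = mod_hom_closed[OF g]
  have g_d: "a \<odot>\<^bsub>Q\<^esub> f x \<ominus>\<^bsub>Q\<^esub> g (d n x) = f (d (Suc n) (h (Suc n) x))" if "x \<in> carrier (P (Suc n))" for x
    using that a dc[OF that] hc[OF dc[OF that]]
    by (simp add: g_def compose_def dh mod_hom_diff[OF f] P_abelian_group
        left_module_abelian_group[OF Q] mod_hom_smult[OF f])
  have g_d_mem: "a \<odot>\<^bsub>Q\<^esub> f x \<ominus>\<^bsub>Q\<^esub> g (d n x) \<in> seq_submodule Q bs" if "x \<in> carrier (P (Suc n))" for x
    unfolding g_d[OF that] by (intro cocycle hc that)
  have "g (d n y) \<in> seq_submodule Q (a # bs)" if y: "y \<in> carrier (P (Suc n))" for y
  proof -
    have "g (d n y) = a \<odot>\<^bsub>Q\<^esub> f y \<oplus>\<^bsub>Q\<^esub> \<ominus>\<^bsub>Q\<^esub> (a \<odot>\<^bsub>Q\<^esub> f y \<ominus>\<^bsub>Q\<^esub> g (d n y))"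
      using a fc[OF y] gc[OF dc[OF y]]
      by (simp add: Q.M.minus_eq Q.M.minus_add Q.M.r_neg Q.M.a_assoc[symmetric])
    then show ?thesis
      using fc[OF y] Q.submodule_minus[OF J g_d_mem[OF y]]
      unfolding seq_submodule.simps by blast
  qed
  from IH[OF g this] obtain w where w: "w \<in> mod_hom R (P n) Q"
    and w_mem: "\<And>x. x \<in> carrier (P n) \<Longrightarrow> w x \<in> seq_submodule Q (a # bs)"
    and w_d: "\<And>y. y \<in> carrier (P (Suc n)) \<Longrightarrow> w (d n y) = g (d n y)"
    by blast
  \<comment> \<open>Pointwise, \<open>w\<close> is a multiple of \<open>a\<close> modulo
    \<open>bs\<close>. Projectivity of \<open>P n\<close> makes the quotients a linear map
    \<open>u\<close>.\<close>
  have "\<exists>u\<in>mod_hom R (P n) Q. \<forall>x\<in>carrier (P n).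
      w x \<ominus>\<^bsub>Q\<^esub> (\<lambda>q\<in>carrier Q. a \<odot>\<^bsub>Q\<^esub> q) (u x) \<in> seq_submodule Q bs"
  proof (rule projective_lift_modulo[OF projective Q Q J mod_hom_homothety[OF is_cring Q a] w])
    fix x assume "x \<in> carrier (P n)"
    then obtain q r where q: "q \<in> carrier Q" and r: "r \<in> seq_submodule Q bs"
      and "w x = a \<odot>\<^bsub>Q\<^esub> q \<oplus>\<^bsub>Q\<^esub> r"
      using w_mem unfolding seq_submodule.simps by blast
    moreover have "r \<in> carrier Q" using r Q.submodule_subset[OF J] by blast
    ultimately have "w x \<ominus>\<^bsub>Q\<^esub> (\<lambda>q\<in>carrier Q. a \<odot>\<^bsub>Q\<^esub> q) q = r"
      using a by (simp add: Q.M.a_comm[of "a \<odot>\<^bsub>Q\<^esub> q"] Q.M.add_diff_cancel)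
    then show "\<exists>q\<in>carrier Q. w x \<ominus>\<^bsub>Q\<^esub> (\<lambda>q\<in>carrier Q. a \<odot>\<^bsub>Q\<^esub> q) q \<in> seq_submodule Q bs"
      using q r by (intro bexI[of _ q]) simp_all
  qed
  then obtain u where u: "u \<in> mod_hom R (P n) Q"
    and u_mem: "\<And>x. x \<in> carrier (P n) \<Longrightarrow> w x \<ominus>\<^bsub>Q\<^esub> a \<odot>\<^bsub>Q\<^esub> u x \<in> seq_submodule Q bs"
    using mod_hom_closed by (metis restrict_apply')
  have "f x \<ominus>\<^bsub>Q\<^esub> u (d n x) \<in> seq_submodule Q bs" if x: "x \<in> carrier (P (Suc n))" for x
  proof -
    have ud: "u (d n x) \<in> carrier Q" by (rule mod_hom_closed[OF u dc[OF x]])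
    \<comment> \<open>The inserted \<open>g (d n x)\<close> equals \<open>w (d n x)\<close>, so both
      differences lie in the submodule of \<open>bs\<close>, and regularity of \<open>a\<close>
      modulo \<open>bs\<close> removes the factor \<open>a\<close>.\<close>
    have "a \<odot>\<^bsub>Q\<^esub> (f x \<ominus>\<^bsub>Q\<^esub> u (d n x)) =
        (a \<odot>\<^bsub>Q\<^esub> f x \<ominus>\<^bsub>Q\<^esub> g (d n x)) \<oplus>\<^bsub>Q\<^esub> (g (d n x) \<ominus>\<^bsub>Q\<^esub> a \<odot>\<^bsub>Q\<^esub> u (d n x))"
      using a ud fc[OF x] gc[OF dc[OF x]]
      by (simp add: Q.smult_r_diff Q.M.diff_add_diff_cancel)
    also have "\<dots> \<in> seq_submodule Q bs"
      by (rule Q.submodule_add[OF J g_d_mem[OF x] u_mem[OF dc[OF x], unfolded w_d[OF x]]])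
    finally show ?thesis
      using reg fc[OF x] ud by simp
  qed
  then show ?thesis using u by blast
qed

text \<open>The conclusion is phrased through \<open>w\<close> to treat all degrees alike: in degree
  zero \<open>w\<close> is \<open>f\<close>, above it \<open>w\<close> is \<open>f\<close> minus a
  coboundary. The next degree needs only the values of \<open>w\<close> and its composite with the
  differential. In the inductive step the last element of \<open>as\<close> moves to the front of
  \<open>bs\<close>.\<close>

lemma cocycle_modulo:
  assumes "length as = Suc n" "set as \<subseteq> carrier R" "set bs \<subseteq> carrier R" "regular_seq Q (as @ bs)"
    and "\<And>a x. \<lbrakk>a \<in> set as; x \<in> carrier M\<rbrakk> \<Longrightarrow> a \<odot>\<^bsub>M\<^esub> x = \<zero>\<^bsub>M\<^esub>"
    and "f \<in> mod_hom R (P n) Q"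
    and "\<And>y. y \<in> carrier (P (Suc n)) \<Longrightarrow> f (d n y) \<in> seq_submodule Q bs"
  shows "\<exists>w\<in>mod_hom R (P n) Q. (\<forall>x\<in>carrier (P n). w x \<in> seq_submodule Q bs) \<and>
    (\<forall>y\<in>carrier (P (Suc n)). w (d n y) = f (d n y))"
  using assms
proof (induction n arbitrary: as bs f)
  case 0
  then obtain a where as: "as = [a]" by (auto simp: length_Suc_conv)
  have "f x \<in> seq_submodule Q bs" if "x \<in> carrier (P 0)" for x
  proof (rule cocycle_0_modulo[OF _ _ _ "0.prems"(6) _ that])
    show "a \<in> carrier R" "\<And>x. x \<in> carrier M \<Longrightarrow> a \<odot>\<^bsub>M\<^esub> x = \<zero>\<^bsub>M\<^esub>" "regular_seq Q (a # bs)"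
      using "0.prems"(2,4,5) as by auto
    show "f (d 0 y) \<in> seq_submodule Q bs" if "y \<in> carrier (P 1)" for y
      using "0.prems"(7)[of y] that by simp
  qed
  then show ?case using "0.prems"(6) by blast
next
  case (Suc n)
  interpret Q: left_module R Q by (rule Q)
  obtain as' a where as: "as = as' @ [a]"
    using Suc.prems(1) by (cases as rule: rev_cases) auto
  have reg: "regular_seq Q (a # bs)"
    using regular_seq_append[of Q as' "a # bs"] Suc.prems(4) as by simp
  have "\<exists>u\<in>mod_hom R (P n) Q. \<forall>x\<in>carrier (P (Suc n)). f x \<ominus>\<^bsub>Q\<^esub> u (d n x) \<in> seq_submodule Q bs"
  proof (rule cocycle_Suc_modulo[OF _ _ Suc.prems(3) reg _ Suc.prems(6,7)])
    show "a \<in> carrier R" "\<And>x. x \<in> carrier M \<Longrightarrow> a \<odot>\<^bsub>M\<^esub> x = \<zero>\<^bsub>M\<^esub>"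
      using Suc.prems(2,5) as by auto
    show "\<exists>w\<in>mod_hom R (P n) Q. (\<forall>x\<in>carrier (P n). w x \<in> seq_submodule Q (a # bs)) \<and>
        (\<forall>y\<in>carrier (P (Suc n)). w (d n y) = g (d n y))"
      if "g \<in> mod_hom R (P n) Q"
        "\<And>y. y \<in> carrier (P (Suc n)) \<Longrightarrow> g (d n y) \<in> seq_submodule Q (a # bs)" for g
      by (rule Suc.IH[OF _ _ _ _ _ that, of as'])
        (use Suc.prems as in \<open>auto simp del: seq_submodule.simps\<close>)
  qed
  then obtain u where u: "u \<in> mod_hom R (P n) Q"
    and u_mem: "\<And>x. x \<in> carrier (P (Suc n)) \<Longrightarrow> f x \<ominus>\<^bsub>Q\<^esub> u (d n x) \<in> seq_submodule Q bs"
    by blast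
  let ?c = "carrier (P (Suc n))"
  define w where "w = (\<lambda>x\<in>?c. f x \<ominus>\<^bsub>Q\<^esub> compose ?c u (d n) x)"
  have "w \<in> mod_hom R (P (Suc n)) Q"
    unfolding w_def by (intro mod_hom_minus_hom P_module Q Suc.prems(6) mod_hom_compose[OF P_module d_hom u])
  moreover have "w x \<in> seq_submodule Q bs" if "x \<in> ?c" for x
    using u_mem[OF that] that by (simp add: w_def compose_def)
  moreover have "w (d (Suc n) y) = f (d (Suc n) y)" if "y \<in> carrier (P (Suc (Suc n)))" for y
    using that mod_hom_closed[OF d_hom that] mod_hom_closed[OF Suc.prems(6)]
    by (simp add: w_def compose_def d_d
        mod_hom_zero[OF u P_abelian_group left_module_abelian_group[OF Q]])
  ultimately show ?case by blast
qed

text \<open>Taking \<open>bs\<close> empty in \<open>cocycle_modulo\<close> would merely give back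
  the cocycle condition, since \<open>w\<close> would be zero and the bounding map \<open>u\<close>
  is not recorded there. Hence \<open>cocycle_Suc_modulo\<close> is applied once more, with
  \<open>cocycle_modulo\<close> supplying its premise one degree lower.\<close>

lemma Ext_vanishing:
  assumes "length as = Suc (Suc n)" "set as \<subseteq> carrier R" "regular_seq Q as"
    and "\<And>a x. \<lbrakk>a \<in> set as; x \<in> carrier M\<rbrakk> \<Longrightarrow> a \<odot>\<^bsub>M\<^esub> x = \<zero>\<^bsub>M\<^esub>"
    and f: "f \<in> mod_hom R (P (Suc n)) Q"
    and cocycle: "\<And>y. y \<in> carrier (P (Suc (Suc n))) \<Longrightarrow> f (d (Suc n) y) = \<zero>\<^bsub>Q\<^esub>"
  shows "\<exists>u\<in>mod_hom R (P n) Q. f = compose (carrier (P (Suc n))) u (d n)"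
proof -
  interpret Q: left_module R Q by (rule Q)
  obtain as' a where as: "as = as' @ [a]"
    using assms(1) by (cases as rule: rev_cases) auto
  have reg: "regular_seq Q [a]"
    using regular_seq_append[of Q as' "[a]"] assms(3) as by simp
  have "\<exists>u\<in>mod_hom R (P n) Q. \<forall>x\<in>carrier (P (Suc n)). f x \<ominus>\<^bsub>Q\<^esub> u (d n x) \<in> seq_submodule Q []"
  proof (rule cocycle_Suc_modulo[OF _ _ _ reg _ f])
    show "a \<in> carrier R" "\<And>x. x \<in> carrier M \<Longrightarrow> a \<odot>\<^bsub>M\<^esub> x = \<zero>\<^bsub>M\<^esub>"
      using assms(2,4) as by auto
    show "\<exists>w\<in>mod_hom R (P n) Q. (\<forall>x\<in>carrier (P n). w x \<in> seq_submodule Q [a]) \<and>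
        (\<forall>y\<in>carrier (P (Suc n)). w (d n y) = g (d n y))"
      if "g \<in> mod_hom R (P n) Q"
        "\<And>y. y \<in> carrier (P (Suc n)) \<Longrightarrow> g (d n y) \<in> seq_submodule Q [a]" for g
      by (rule cocycle_modulo[OF _ _ _ _ _ that, of as'])
        (use assms as in \<open>auto simp del: seq_submodule.simps\<close>)
  qed (use cocycle in auto)
  then obtain u where u: "u \<in> mod_hom R (P n) Q"
    and fu: "\<And>x. x \<in> carrier (P (Suc n)) \<Longrightarrow> f x \<ominus>\<^bsub>Q\<^esub> u (d n x) = \<zero>\<^bsub>Q\<^esub>"
    by auto
  have "f x = u (d n x)" if "x \<in> carrier (P (Suc n))" for x
    using fu[OF that] mod_hom_closed[OF f that] mod_hom_closed[OF u mod_hom_closed[OF d_hom that]]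
    by (simp only: Q.M.diff_zero_iff)
  then have "f = compose (carrier (P (Suc n))) u (d n)"
    by (intro mod_hom_eqI[OF f mod_hom_compose[OF P_module d_hom u]]) (simp add: compose_def)
  then show ?thesis using u by blast
qed

end

end


section \<open>Variables form regular sequences\<close>

lemma carrier_poly_ring: "carrier (poly_ring A) = {p. \<forall>m\<in>Poly_Mapping.keys p. Poly_Mapping.keys m \<subseteq> A}"
  by (simp add: poly_ring_def)

lemma poly_ring_simps [simp]:
  "\<zero>\<^bsub>poly_ring A\<^esub> = 0" "\<one>\<^bsub>poly_ring A\<^esub> = 1"
  "p \<oplus>\<^bsub>poly_ring A\<^esub> q = p + q" "p \<otimes>\<^bsub>poly_ring A\<^esub> q = p * q"
  by (simp_all add: poly_ring_def)

lemma cring_poly_ring: "cring (poly_ring A :: (('x \<Rightarrow>\<^sub>0 nat) \<Rightarrow>\<^sub>0 'k::field) ring)"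
proof -
  let ?R = "poly_ring A :: (('x \<Rightarrow>\<^sub>0 nat) \<Rightarrow>\<^sub>0 'k) ring"
  have add: "p + q \<in> carrier ?R" if "p \<in> carrier ?R" "q \<in> carrier ?R" for p q
    using that keys_add[of p q] unfolding carrier_poly_ring by blast
  have mult: "p * q \<in> carrier ?R" if "p \<in> carrier ?R" "q \<in> carrier ?R" for p q
  proof -
    have "Poly_Mapping.keys m \<subseteq> A" if m: "m \<in> Poly_Mapping.keys (p * q)" for m
    proof -
      obtain a b where "m = a + b" "a \<in> Poly_Mapping.keys p" "b \<in> Poly_Mapping.keys q"
        using m keys_mult[of p q] by blast
      then show ?thesis
        using \<open>p \<in> carrier ?R\<close> \<open>q \<in> carrier ?R\<close> keys_add[of a b] unfolding carrier_poly_ring by blast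
    qed
    then show ?thesis unfolding carrier_poly_ring by blast
  qed
  show ?thesis
  proof (rule cringI)
    show "abelian_group ?R"
    proof (rule abelian_groupI)
      fix p assume "p \<in> carrier ?R"
      then have "- p \<in> carrier ?R" by (simp add: carrier_poly_ring in_keys_iff)
      then show "\<exists>q\<in>carrier ?R. q \<oplus>\<^bsub>?R\<^esub> p = \<zero>\<^bsub>?R\<^esub>" by (intro bexI[of _ "- p"]) simp_all
    qed (auto simp: add add_ac, auto simp: carrier_poly_ring)
    show "comm_monoid ?R"
      by (rule comm_monoidI) (auto simp: mult mult_ac, auto simp: carrier_poly_ring)
  qed (simp add: distrib_right)
qed

text \<open>Monomials cancel, so at most one term of the convolution sum survives.\<close>

lemma lookup_single_times:
  fixes u m :: "'x \<Rightarrow>\<^sub>0 nat" and p :: "('x \<Rightarrow>\<^sub>0 nat) \<Rightarrow>\<^sub>0 'k::field"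
  shows "Poly_Mapping.lookup (Poly_Mapping.single u 1 * p) (u + m) = Poly_Mapping.lookup p m"
    and "(\<nexists>m'. n = u + m') \<Longrightarrow> Poly_Mapping.lookup (Poly_Mapping.single u 1 * p) n = 0"
proof -
  have "Poly_Mapping.lookup (Poly_Mapping.single u 1 * p) n =
      (\<Sum>q. Poly_Mapping.lookup p q when n = u + q)" for n
    by (simp add: lookup_mult lookup_single when_mult)
  then show "Poly_Mapping.lookup (Poly_Mapping.single u 1 * p) (u + m) = Poly_Mapping.lookup p m"
    and "(\<nexists>m'. n = u + m') \<Longrightarrow> Poly_Mapping.lookup (Poly_Mapping.single u 1 * p) n = 0"
    by auto
qed

section \<open>Multiplication and division by a variable\<close>

definition var :: "'x \<Rightarrow> (('x \<Rightarrow>\<^sub>0 nat) \<Rightarrow>\<^sub>0 'k::field)"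
  where "var a = Poly_Mapping.single (Poly_Mapping.single a 1) 1"

lemma var_carrier: "a \<in> A \<Longrightarrow> var a \<in> carrier (poly_ring A)"
  by (simp add: var_def carrier_poly_ring)

lemma in_keys_iff_single_plus:
  fixes m :: "'x \<Rightarrow>\<^sub>0 nat"
  shows "a \<in> Poly_Mapping.keys m \<longleftrightarrow> (\<exists>m'. m = Poly_Mapping.single a 1 + m')"
proof
  assume "a \<in> Poly_Mapping.keys m"
  \<comment> \<open>Subtraction of exponents truncates at zero; it loses nothing here because the
    exponent of \<open>a\<close> is positive.\<close>
  then have "m = Poly_Mapping.single a 1 + (m - Poly_Mapping.single a 1)"
    by (intro poly_mapping_eqI)
      (auto simp: lookup_add lookup_minus lookup_single in_keys_iff when_def)
  then show "\<exists>m'. m = Poly_Mapping.single a 1 + m'" ..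
qed (auto simp: in_keys_iff lookup_add)

lemma lookup_var_times:
  fixes m :: "'x \<Rightarrow>\<^sub>0 nat" and p :: "('x \<Rightarrow>\<^sub>0 nat) \<Rightarrow>\<^sub>0 'k::field"
  shows "Poly_Mapping.lookup (var a * p) (Poly_Mapping.single a 1 + m) = Poly_Mapping.lookup p m"
    and "a \<notin> Poly_Mapping.keys n \<Longrightarrow> Poly_Mapping.lookup (var a * p) n = 0"
  unfolding var_def in_keys_iff_single_plus by - (rule lookup_single_times | assumption)+

lemma keys_single_plus:
  fixes m :: "'x \<Rightarrow>\<^sub>0 nat"
  shows "Poly_Mapping.keys (Poly_Mapping.single a 1 + m) = insert a (Poly_Mapping.keys m)"
  by (auto simp: in_keys_iff lookup_add lookup_single when_def split: if_splits)

text \<open>The quotient of division by the variable \<open>a\<close>: shifting exponents down drops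
  exactly the terms not divisible by it.\<close>

definition var_div :: "'x \<Rightarrow> (('x \<Rightarrow>\<^sub>0 nat) \<Rightarrow>\<^sub>0 'k) \<Rightarrow> (('x \<Rightarrow>\<^sub>0 nat) \<Rightarrow>\<^sub>0 'k::field)"
  where "var_div a p = Poly_Mapping.map_key ((+) (Poly_Mapping.single a 1)) p"

lemma lookup_var_div:
  "Poly_Mapping.lookup (var_div a p) m = Poly_Mapping.lookup p (Poly_Mapping.single a 1 + m)"
  by (simp add: var_div_def map_key.rep_eq)

lemma lookup_minus_var_times_var_div:
  "Poly_Mapping.lookup (p - var a * var_div a p) m =
    (if a \<in> Poly_Mapping.keys m then 0 else Poly_Mapping.lookup p m)"
proof (cases "a \<in> Poly_Mapping.keys m")
  case True
  then obtain m' where m: "m = Poly_Mapping.single a 1 + m'"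
    unfolding in_keys_iff_single_plus ..
  have "Poly_Mapping.lookup (p - var a * var_div a p) m = 0"
    unfolding m lookup_minus lookup_var_times lookup_var_div by simp
  then show ?thesis using True by simp
qed (simp add: lookup_minus lookup_var_times)

lemma left_module_free_poly: "left_module (poly_ring A) (free_module (poly_ring A) I)"
  by (rule left_module_free[OF cring.axioms(1)[OF cring_poly_ring]])

text \<open>An ideal generated by variables is a monomial ideal, so membership can be read off
  monomial by monomial. This turns regularity into combinatorics of supports.\<close>

lemma seq_submodule_vars:
  fixes A :: "'x set" and I :: "'i set"
  defines "F \<equiv> free_module (poly_ring A :: (('x \<Rightarrow>\<^sub>0 nat) \<Rightarrow>\<^sub>0 'k::field) ring) I"
  assumes "set as \<subseteq> A"
  shows "seq_submodule F (map var as) =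
    {f \<in> carrier F. \<forall>i\<in>I. \<forall>m\<in>Poly_Mapping.keys (f i). Poly_Mapping.keys m \<inter> set as \<noteq> {}}"
  using assms(2)
proof (induction as)
  case Nil
  have "f = (\<lambda>i\<in>I. 0)" if "f \<in> carrier F" "\<forall>i\<in>I. Poly_Mapping.keys (f i) = {}" for f
    using that by (auto simp: F_def free_module_def PiE_iff extensional_def)
  moreover have "(\<lambda>i\<in>I. 0) \<in> carrier F"
    using left_module.smult_closed left_module_free_poly[of A I]
    by (auto simp: F_def free_module_def carrier_poly_ring)
  ultimately show ?case by (auto simp: F_def free_module_def)
next
  case (Cons a as)
  let ?R = "poly_ring A :: (('x \<Rightarrow>\<^sub>0 nat) \<Rightarrow>\<^sub>0 'k) ring"
  interpret F: left_module ?R F unfolding F_def by (rule left_module_free_poly)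
  have a: "a \<in> A" and as: "set as \<subseteq> A" using Cons.prems by auto
  have var: "var a \<in> carrier ?R" by (rule var_carrier[OF a])
  have op: "(var a \<odot>\<^bsub>F\<^esub> f \<oplus>\<^bsub>F\<^esub> g) = (\<lambda>i\<in>I. var a * f i + g i)" for f g
    by (auto simp: F_def free_module_def)
  show ?case
  proof (intro subset_antisym subsetI)
    fix f assume "f \<in> seq_submodule F (map var (a # as))"
    then obtain x y where f: "f = var a \<odot>\<^bsub>F\<^esub> x \<oplus>\<^bsub>F\<^esub> y" "x \<in> carrier F"
      and y: "y \<in> carrier F"
        "\<forall>i\<in>I. \<forall>m\<in>Poly_Mapping.keys (y i). Poly_Mapping.keys m \<inter> set as \<noteq> {}"
      unfolding list.map seq_submodule.simps Cons.IH[OF as] by blast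
    have "f \<in> carrier F" using f y var by simp
    moreover have "Poly_Mapping.keys m \<inter> set (a # as) \<noteq> {}"
      if i: "i \<in> I" and m: "m \<in> Poly_Mapping.keys (f i)" for i m
    proof (cases "a \<in> Poly_Mapping.keys m")
      case False
      then have "m \<in> Poly_Mapping.keys (y i)"
        using m i unfolding f op by (simp add: in_keys_iff lookup_add lookup_var_times)
      then show ?thesis using y i by auto
    qed auto
    ultimately show "f \<in> {f \<in> carrier F. \<forall>i\<in>I. \<forall>m\<in>Poly_Mapping.keys (f i).
      Poly_Mapping.keys m \<inter> set (a # as) \<noteq> {}}" by blast
  next
    fix f assume "f \<in> {f \<in> carrier F. \<forall>i\<in>I. \<forall>m\<in>Poly_Mapping.keys (f i).
      Poly_Mapping.keys m \<inter> set (a # as) \<noteq> {}}"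
    then have f: "f \<in> carrier F"
      and meets: "\<And>i m. i \<in> I \<Longrightarrow> m \<in> Poly_Mapping.keys (f i) \<Longrightarrow>
        Poly_Mapping.keys m \<inter> set (a # as) \<noteq> {}" by auto
    have fR: "f i \<in> carrier ?R" if "i \<in> I" for i
      using f that by (auto simp: F_def free_module_def)
    have ffin: "finite {i \<in> I. f i \<noteq> 0}" using f by (simp add: F_def free_module_def)
    \<comment> \<open>Coordinatewise division by the variable. The remainder \<open>r\<close> keeps
      the monomials of \<open>f\<close> that avoid \<open>a\<close>; they still meet
      \<open>a # as\<close>, hence meet \<open>as\<close>, and the induction hypothesis applies to
      \<open>r\<close>.\<close>
    define q where "q = (\<lambda>i\<in>I. var_div a (f i))"
    define r where "r = (\<lambda>i\<in>I. f i - var a * var_div a (f i))"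
    have r_lookup: "Poly_Mapping.lookup (r i) m =
        (if a \<in> Poly_Mapping.keys m then 0 else Poly_Mapping.lookup (f i) m)" if "i \<in> I" for i m
      using that by (simp add: r_def lookup_minus_var_times_var_div)
    have r_keys: "Poly_Mapping.keys (r i) = {m \<in> Poly_Mapping.keys (f i). a \<notin> Poly_Mapping.keys m}"
      if "i \<in> I" for i
      using r_lookup[OF that] by (simp add: set_eq_iff in_keys_iff)
    have "q i \<in> carrier ?R" if "i \<in> I" for i
      unfolding carrier_poly_ring
    proof safe
      fix m x assume "m \<in> Poly_Mapping.keys (q i)" "x \<in> Poly_Mapping.keys m"
      then have "Poly_Mapping.single a 1 + m \<in> Poly_Mapping.keys (f i)"
        using that by (simp add: q_def in_keys_iff lookup_var_div)
      then have "Poly_Mapping.keys (Poly_Mapping.single a 1 + m) \<subseteq> A"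
        using fR[OF that] unfolding carrier_poly_ring by blast
      then show "x \<in> A" using \<open>x \<in> Poly_Mapping.keys m\<close> by (simp only: keys_single_plus) blast
    qed
    moreover have "r i \<in> carrier ?R" if "i \<in> I" for i
      using fR[OF that] r_keys[OF that] unfolding carrier_poly_ring by auto
    moreover have "finite {i \<in> I. q i \<noteq> 0}"
      by (rule finite_subset[OF _ ffin])
        (auto simp: q_def poly_mapping_eq_iff lookup_var_div fun_eq_iff)
    moreover have "finite {i \<in> I. r i \<noteq> 0}"
      by (rule finite_subset[OF _ ffin])
        (auto simp: poly_mapping_eq_iff r_lookup fun_eq_iff split: if_splits)
    ultimately have q: "q \<in> carrier F" and r: "r \<in> carrier F"
      by (auto simp: F_def free_module_def q_def r_def)
    have "r \<in> seq_submodule F (map var as)"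
      unfolding Cons.IH[OF as] using r r_keys meets by fastforce
    moreover have "f = var a \<odot>\<^bsub>F\<^esub> q \<oplus>\<^bsub>F\<^esub> r"
      unfolding op using f by (auto simp: q_def r_def F_def free_module_def PiE_iff extensional_def)
    ultimately show "f \<in> seq_submodule F (map var (a # as))"
      using q unfolding list.map seq_submodule.simps by blast
  qed
qed

text \<open>Multiplication by the variable \<open>a\<close> adds only \<open>a\<close> to the
  support of each monomial, and \<open>a\<close> is not among the later variables. So it cannot
  create a meeting with them.\<close>

lemma regular_seq_vars:
  fixes A :: "'x set" and I :: "'i set"
  assumes "set as \<subseteq> A" "distinct as"
  shows "regular_seq (free_module (poly_ring A :: (('x \<Rightarrow>\<^sub>0 nat) \<Rightarrow>\<^sub>0 'k::field) ring) I) (map var as)"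
  using assms
proof (induction as)
  case (Cons a as)
  let ?F = "free_module (poly_ring A :: (('x \<Rightarrow>\<^sub>0 nat) \<Rightarrow>\<^sub>0 'k) ring) I"
  have as: "set as \<subseteq> A" and notin: "a \<notin> set as" using Cons.prems by auto
  have "f \<in> seq_submodule ?F (map var as)"
    if f: "f \<in> carrier ?F" and af: "var a \<odot>\<^bsub>?F\<^esub> f \<in> seq_submodule ?F (map var as)" for f
  proof -
    have "Poly_Mapping.keys m \<inter> set as \<noteq> {}" if i: "i \<in> I" and m: "m \<in> Poly_Mapping.keys (f i)" for i m
    proof -
      have "Poly_Mapping.single a 1 + m \<in> Poly_Mapping.keys ((var a \<odot>\<^bsub>?F\<^esub> f) i)"
        using i m by (simp add: free_module_def in_keys_iff lookup_var_times del: One_nat_def)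
      then have "Poly_Mapping.keys (Poly_Mapping.single a 1 + m) \<inter> set as \<noteq> {}"
        using af i unfolding seq_submodule_vars[OF as] by blast
      then show ?thesis using notin unfolding keys_single_plus by blast
    qed
    then show ?thesis using f unfolding seq_submodule_vars[OF as] by blast
  qed
  then show ?case using Cons by simp
qed simp

lemma residue_module_var: "var a \<odot>\<^bsub>residue_module\<^esub> c = 0"
proof -
  have "Poly_Mapping.single a (1::nat) \<noteq> 0"
    by (metis lookup_single_eq lookup_zero zero_neq_one)
  then show ?thesis
    by (simp add: residue_module_def var_def lookup_single_not_eq del: One_nat_def)
qed


section \<open>The complex of homomorphisms\<close>

text \<open>Since \<open>M\<close> is a retract of \<open>Q\<close>, a linear map from \<open>Hom(M, Q)\<close> is determined by its value at
  the inclusion of \<open>M\<close> into \<open>Q\<close>.\<close>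

lemma surjective_if_Hom_split:
  assumes M: "left_module R M" and Q: "left_module R Q"
    and g: "g \<in> mod_hom R M N" and "mod_retract R M Q" "mod_retract R N Q"
    and H: "H \<in> mod_hom (End_ring R Q) (Hom_module R M Q) (Hom_module R N Q)"
    and split: "\<And>f. f \<in> mod_hom R N Q \<Longrightarrow> H (compose (carrier M) f g) = f"
  shows "g ` carrier M = carrier N"
proof
  obtain j q where j: "j \<in> mod_hom R M Q" and q: "q \<in> mod_hom R Q M"
    and qj: "\<And>x. x \<in> carrier M \<Longrightarrow> q (j x) = x"
    using assms(4) unfolding mod_retract_def by blast
  obtain i p where i: "i \<in> mod_hom R N Q" and p: "p \<in> mod_hom R Q N"
    and pi: "\<And>x. x \<in> carrier N \<Longrightarrow> p (i x) = x"
    using assms(5) unfolding mod_retract_def by blast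
  \<comment> \<open>The endomorphism extending \<open>i\<close> after \<open>g\<close> along
    \<open>j\<close>, so that the precomposite of \<open>i\<close> with \<open>g\<close> is the
    scalar multiple of \<open>j\<close> by \<open>s\<close>. Linearity of \<open>H\<close> then
    gives \<open>i = s (H j)\<close>, and cancelling \<open>i\<close> by means of \<open>p\<close>
    shows that \<open>q\<close> after \<open>H j\<close> is a section of \<open>g\<close>.\<close>
  define s where "s = compose (carrier Q) i (compose (carrier Q) g q)"
  have s: "s \<in> carrier (End_ring R Q)"
    unfolding s_def End_ring_def by (simp add: mod_hom_compose[OF Q mod_hom_compose[OF Q q g] i])
  have Hj: "H j \<in> mod_hom R N Q"
    using mod_hom_closed[OF H, of j] j by (simp add: Hom_module_def)
  have "compose (carrier M) i g = s \<odot>\<^bsub>Hom_module R M Q\<^esub> j"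
    by (auto simp: s_def Hom_module_def compose_def qj mod_hom_closed[OF j] intro!: restrict_ext)
  then have i_eq: "i = s \<odot>\<^bsub>Hom_module R N Q\<^esub> H j"
    using split[OF i] mod_hom_smult[OF H s, of j] j by (simp add: Hom_module_def)
  show "carrier N \<subseteq> g ` carrier M"
  proof
    fix y assume y: "y \<in> carrier N"
    have Hjy: "H j y \<in> carrier Q" by (rule mod_hom_closed[OF Hj y])
    have "i y = (s \<odot>\<^bsub>Hom_module R N Q\<^esub> H j) y" using i_eq by simp
    also have "\<dots> = i (g (q (H j y)))"
      using y Hjy by (simp add: s_def Hom_module_def compose_def)
    finally have "y = g (q (H j y))"
      using pi y mod_hom_closed[OF g mod_hom_closed[OF q Hjy]] by metis
    then show "y \<in> g ` carrier M" using mod_hom_closed[OF q Hjy] by blast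
  qed
  show "g ` carrier M \<subseteq> carrier N" using mod_hom_closed[OF g] by blast
qed

text \<open>With this, the negative degrees are finitely generated projective by the same argument
  as the others.\<close>

lemma (in left_module) mod_retract_zero_module: "mod_retract R zero_module M"
proof -
  have Z: "left_module R zero_module" by (rule left_module_zero_module[OF R.ring_axioms])
  have "zero_hom M zero_module (zero_hom zero_module M x) = x" if "x \<in> carrier zero_module"
    for x :: 'e
    using that by (simp add: zero_hom_def zero_module_def)
  then show ?thesis
    unfolding mod_retract_def
    by (intro bexI[of _ "zero_hom zero_module M"] bexI[of _ "zero_hom M zero_module"] ballI
        mod_hom_zero_hom Z left_module_axioms)
qed

lemma Hom_zero_module:
  assumes "left_module R Q"
  shows "mod_hom R (zero_module :: ('r, 'm) module) Q = {zero_hom zero_module Q}"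
  using assms mod_hom_from_zero_module[OF left_module_abelian_group[OF assms]]
    mod_hom_zero_hom[OF left_module_zero_module[OF left_module_ring[OF assms]] assms]
  by auto

section \<open>The truncated resolution indexed by the integers\<close>

context cring_resolution
begin

lemma truncated_obj_int: "truncated_obj P (int n) = P n"
  and truncated_diff_int: "truncated_diff P d (int n) = d n"
  by (simp_all add: truncated_obj_def truncated_diff_def)

lemma truncated_obj_neg: "n < 0 \<Longrightarrow> truncated_obj P n = zero_module"
  and truncated_diff_neg:
    "n < 0 \<Longrightarrow> truncated_diff P d n = zero_hom (truncated_obj P (n + 1)) (truncated_obj P n)"
  by (simp_all add: truncated_obj_def truncated_diff_def)

lemma truncated_module: "left_module R (truncated_obj P n)"
  by (simp add: truncated_obj_def P_module left_module_zero_module[OF ring_axioms])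

lemma truncated_diff_hom:
  "truncated_diff P d n \<in> mod_hom R (truncated_obj P (n + 1)) (truncated_obj P n)"
proof (cases "0 \<le> n")
  case True
  then obtain k where n: "n = int k" using nonneg_int_cases by blast
  have "n + 1 = int (Suc k)" by (simp add: n)
  then show ?thesis using d_hom[of k] by (simp only: n truncated_obj_int truncated_diff_int)
next
  case False
  then show ?thesis by (simp add: truncated_diff_neg mod_hom_zero_hom truncated_module)
qed

lemma truncated_diff_diff:
  assumes "x \<in> carrier (truncated_obj P (n + 2))"
  shows "truncated_diff P d n (truncated_diff P d (n + 1) x) = \<zero>\<^bsub>truncated_obj P n\<^esub>"
proof (cases "0 \<le> n")
  case True
  then obtain k where n: "n = int k" using nonneg_int_cases by blast
  have n': "n + 1 = int (Suc k)" "n + 2 = int (Suc (Suc k))" by (simp_all add: n)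
  show ?thesis
    using assms d_d[of x k] unfolding n' by (simp only: n truncated_obj_int truncated_diff_int)
next
  \<comment> \<open>In degree -1 the inner differential is \<open>d 0\<close>, in general nonzero,
    but the outer one maps into the zero module.\<close>
  case False
  have "truncated_diff P d (n + 1) x \<in> carrier (truncated_obj P (n + 1))"
    using mod_hom_closed[OF truncated_diff_hom[of "n + 1"]] assms by (simp add: add.commute)
  then show ?thesis using False by (simp add: truncated_diff_neg zero_hom_def)
qed

section \<open>The Hom complex: acyclicity and contractibility\<close>

context
  fixes Q :: "('r, 'q) module"
  assumes Q: "left_module R Q"
begin

abbreviation "C \<equiv> Hom_complex_obj R (truncated_obj P) Q"
abbreviation "\<delta> \<equiv> Hom_complex_diff R (truncated_obj P) (truncated_diff P d) Q"

lemma C_carrier: "carrier (C n) = mod_hom R (truncated_obj P n) Q"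
  and C_zero: "\<zero>\<^bsub>C n\<^esub> = zero_hom (truncated_obj P n) Q"
  by (simp_all add: Hom_complex_obj_def Hom_module_def)

lemma C_module: "left_module (End_ring R Q) (C n)"
  unfolding Hom_complex_obj_def by (rule Hom_module_left_module[OF truncated_module Q])

lemma \<delta>_hom: "\<delta> n \<in> mod_hom (End_ring R Q) (C n) (C (n + 1))"
  unfolding Hom_complex_obj_def Hom_complex_diff_def
  by (rule Hom_module_precompose[OF truncated_module truncated_module Q truncated_diff_hom])

lemma \<delta>_apply:
  "f \<in> carrier (C n) \<Longrightarrow>
    \<delta> n f = compose (carrier (truncated_obj P (n + 1))) f (truncated_diff P d n)"
  by (simp add: C_carrier Hom_complex_diff_def)

lemma \<delta>_\<delta>:
  assumes "f \<in> carrier (C n)"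
  shows "\<delta> (n + 1) (\<delta> n f) = \<zero>\<^bsub>C (n + 2)\<^esub>"
proof -
  have f: "f \<in> mod_hom R (truncated_obj P n) Q" using assms by (simp add: C_carrier)
  have "\<delta> n f \<in> carrier (C (n + 1))" by (rule mod_hom_closed[OF \<delta>_hom assms])
  then have "\<delta> (n + 1) (\<delta> n f) =
      (\<lambda>x\<in>carrier (truncated_obj P (n + 2)). f (truncated_diff P d n (truncated_diff P d (n + 1) x)))"
    using mod_hom_closed[OF truncated_diff_hom[of "n + 1"]]
    by (auto simp: \<delta>_apply assms compose_def add.commute intro!: restrict_ext)
  also have "\<dots> = \<zero>\<^bsub>C (n + 2)\<^esub>"
    unfolding C_zero zero_hom_def
    by (intro restrict_ext)
      (simp add: truncated_diff_diff mod_hom_zero[OF f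
          left_module_abelian_group[OF truncated_module] left_module_abelian_group[OF Q]])
  finally show ?thesis .
qed

lemma Hom_complex: "cochain_complex (End_ring R Q) C \<delta>"
  by (simp add: cochain_complex_def C_module \<delta>_hom \<delta>_\<delta>)

lemma C_neg: "n < 0 \<Longrightarrow> carrier (C n) = {\<zero>\<^bsub>C n\<^esub>}"
  by (simp add: C_carrier C_zero truncated_obj_neg Hom_zero_module[OF Q])

lemma \<delta>_zero: "\<delta> n \<zero>\<^bsub>C n\<^esub> = \<zero>\<^bsub>C (n + 1)\<^esub>"
  by (intro mod_hom_zero[OF \<delta>_hom] left_module_abelian_group[OF C_module])

lemma C_zero_closed: "\<zero>\<^bsub>C n\<^esub> \<in> carrier (C n)"
  using mod_hom_zero_hom[OF truncated_module Q] by (simp add: C_carrier C_zero)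

text \<open>Exactness in degree k uses a sequence of length k + 1, so arbitrarily long sequences are
  required.\<close>

lemma Hom_complex_acyclic:
  assumes reg: "\<And>n. \<exists>as. length as = n \<and> set as \<subseteq> carrier R \<and> regular_seq Q as \<and>
      (\<forall>a\<in>set as. \<forall>x\<in>carrier M. a \<odot>\<^bsub>M\<^esub> x = \<zero>\<^bsub>M\<^esub>)"
  shows "acyclic_complex C \<delta>"
  unfolding acyclic_complex_def
proof (intro allI subset_antisym subsetI)
  fix n f assume "f \<in> \<delta> (n - 1) ` carrier (C (n - 1))"
  then show "f \<in> {f \<in> carrier (C n). \<delta> n f = \<zero>\<^bsub>C (n + 1)\<^esub>}"
    using \<delta>_\<delta>[of _ "n - 1"] mod_hom_closed[OF \<delta>_hom[of "n - 1"]]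
    by (auto simp: add.commute)
next
  fix n f assume "f \<in> {f \<in> carrier (C n). \<delta> n f = \<zero>\<^bsub>C (n + 1)\<^esub>}"
  then have f: "f \<in> carrier (C n)" and df: "\<delta> n f = \<zero>\<^bsub>C (n + 1)\<^esub>" by auto
  have zero: "\<zero>\<^bsub>C n\<^esub> \<in> \<delta> (n - 1) ` carrier (C (n - 1))"
    using \<delta>_zero[of "n - 1"] C_zero_closed[of "n - 1"] by force
  show "f \<in> \<delta> (n - 1) ` carrier (C (n - 1))"
  proof (cases "0 \<le> n")
    case False
    then show ?thesis using f zero C_neg by auto
  next
    case True
    then obtain k where n: "n = int k" using nonneg_int_cases by blast
    have n1: "n + 1 = int (Suc k)" by (simp add: n)
    have T: "truncated_obj P n = P k" "truncated_obj P (n + 1) = P (Suc k)"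
      "truncated_diff P d n = d k"
      unfolding n1 unfolding n truncated_obj_int truncated_diff_int by (rule refl)+
    have f': "f \<in> mod_hom R (P k) Q" using f by (simp add: C_carrier T)
    have fd: "f (d k y) = \<zero>\<^bsub>Q\<^esub>" if y: "y \<in> carrier (P (Suc k))" for y
    proof -
      have "f (d k y) = \<delta> n f y"
        using y by (simp add: \<delta>_apply[OF f] T compose_def)
      also have "\<dots> = \<zero>\<^bsub>Q\<^esub>"
        using y by (simp add: df C_zero T zero_hom_def)
      finally show ?thesis .
    qed
    show ?thesis
    proof (cases k)
      case 0
      \<comment> \<open>The term in degree -1 is zero, so exactness in degree 0 means that cocycles
        vanish; a single regular element annihilating \<open>M\<close> achieves this.\<close>
      obtain a where a: "a \<in> carrier R" "regular_seq Q [a]"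
        "\<And>x. x \<in> carrier M \<Longrightarrow> a \<odot>\<^bsub>M\<^esub> x = \<zero>\<^bsub>M\<^esub>"
        using reg[of 1] by (auto simp: length_Suc_conv)
      have "f x \<in> seq_submodule Q []" if "x \<in> carrier (P 0)" for x
      proof (rule cocycle_0_modulo[OF Q a(1,3,2) _ _ that])
        show "f \<in> mod_hom R (P 0) Q" using f' 0 by simp
        show "f (d 0 y) \<in> seq_submodule Q []" if "y \<in> carrier (P 1)" for y
          using fd 0 that by simp
      qed
      then have "f = \<zero>\<^bsub>C n\<^esub>"
        using mod_hom_extensional[OF f'] 0
        by (auto simp: C_zero T zero_hom_def extensional_def)
      then show ?thesis using zero by simp
    next
      case (Suc m)
      have nm: "n - 1 = int m" by (simp add: n Suc)
      obtain as where as: "length as = Suc (Suc m)" "set as \<subseteq> carrier R" "regular_seq Q as"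
        "\<And>a x. \<lbrakk>a \<in> set as; x \<in> carrier M\<rbrakk> \<Longrightarrow> a \<odot>\<^bsub>M\<^esub> x = \<zero>\<^bsub>M\<^esub>"
        using reg[of "Suc (Suc m)"] by blast
      have "\<exists>u\<in>mod_hom R (P m) Q. f = compose (carrier (P (Suc m))) u (d m)"
        by (rule Ext_vanishing[OF Q as]) (use f' fd Suc in auto)
      then obtain u where u: "u \<in> mod_hom R (P m) Q"
        and fu: "f = compose (carrier (P (Suc m))) u (d m)" by blast
      have uC: "u \<in> carrier (C (n - 1))"
        using u by (simp only: C_carrier nm truncated_obj_int)
      have "\<delta> (n - 1) u = f"
        by (simp add: \<delta>_apply[OF uC] fu T Suc) (simp only: nm truncated_diff_int)
      then show ?thesis using uC by blast
    qed
  qed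
qed

text \<open>The lowest component of a contraction splits precomposition with \<open>d 0\<close>,
  which forces \<open>d 0\<close> to be surjective. Then \<epsilon> vanishes, although its image is
  all of \<open>M\<close>.\<close>

lemma Hom_complex_contractible_imp_trivial:
  assumes retr: "\<And>n. mod_retract R (P n) Q" and "contractible_complex (End_ring R Q) C \<delta>"
  shows "carrier M = {\<zero>\<^bsub>M\<^esub>}"
proof -
  obtain h where h: "\<And>n. h n \<in> mod_hom (End_ring R Q) (C n) (C (n - 1))"
    and id: "\<And>n x. x \<in> carrier (C n) \<Longrightarrow> x = \<delta> (n - 1) (h n x) \<oplus>\<^bsub>C n\<^esub> h (n + 1) (\<delta> n x)"
    using assms(2) unfolding contractible_complex_def null_homotopic_def by auto
  interpret C0: left_module "End_ring R Q" "C 0" by (rule C_module)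
  have T: "truncated_obj P 0 = P 0" "truncated_obj P 1 = P 1" "truncated_diff P d 0 = d 0"
    using truncated_obj_int[of 0] truncated_obj_int[of 1] truncated_diff_int[of 0] by simp_all
  have h1: "h 1 \<in> mod_hom (End_ring R Q) (Hom_module R (P 1) Q) (Hom_module R (P 0) Q)"
    using h[of 1] by (simp add: Hom_complex_obj_def T)
  have split: "h 1 (compose (carrier (P 1)) f (d 0)) = f" if "f \<in> mod_hom R (P 0) Q" for f
  proof -
    have f: "f \<in> carrier (C 0)" using that by (simp add: C_carrier T)
    \<comment> \<open>The lower half of the homotopy identity passes through degree -1, where the
      complex is zero; what remains is \<open>f = h 1 (\<delta> 0 f)\<close>.\<close>
    have "h 0 f \<in> carrier (C (-1))" using mod_hom_closed[OF h[of 0] f] by simp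
    then have "h 0 f = \<zero>\<^bsub>C (-1)\<^esub>" using C_neg[of "-1"] by auto
    then have "\<delta> (-1) (h 0 f) = \<zero>\<^bsub>C 0\<^esub>" using \<delta>_zero[of "-1"] by simp
    moreover have "h 1 (\<delta> 0 f) \<in> carrier (C 0)"
      using mod_hom_closed[OF h[of 1]] mod_hom_closed[OF \<delta>_hom[of 0] f] by simp
    ultimately have "f = h 1 (\<delta> 0 f)" using id[OF f] by simp
    then show ?thesis using \<delta>_apply[OF f] by (simp add: T)
  qed
  have "d 0 ` carrier (P 1) = carrier (P 0)"
    by (rule surjective_if_Hom_split[OF P_module Q _ retr retr h1 split]) (use d_hom[of 0] in simp_all)
  then have "\<epsilon> x = \<zero>\<^bsub>M\<^esub>" if "x \<in> carrier (P 0)" for x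
    using kernel_0 that by blast
  moreover have "\<zero>\<^bsub>M\<^esub> \<in> carrier M"
    using left_module_abelian_group[OF M_module]
    by (simp add: abelian_group_def abelian_monoid.zero_closed)
  ultimately show ?thesis using eps_surj by auto
qed

end

end

theorem corollary4p1:
  fixes A :: "'x set"
    and P :: "nat \<Rightarrow> (('x \<Rightarrow>\<^sub>0 nat) \<Rightarrow>\<^sub>0 'k::field, 'm) module"
    and d :: "nat \<Rightarrow> 'm \<Rightarrow> 'm"
    and \<epsilon> :: "'m \<Rightarrow> 'k"
    and Q :: "(('x \<Rightarrow>\<^sub>0 nat) \<Rightarrow>\<^sub>0 'k, 'p) module"
  assumes "infinite A"
    and "projective_resolution (poly_ring A) P d \<epsilon> residue_module"
    and "projective_module (poly_ring A) Q"
    and "\<And>n. direct_summand (poly_ring A) (P n) Q"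
  shows "let R = poly_ring A;
             S = End_ring R Q;
             C = Hom_complex_obj R (truncated_obj P) Q;
             \<delta> = Hom_complex_diff R (truncated_obj P) (truncated_diff P d) Q
         in cochain_complex S C \<delta> \<and>
            bounded_below_complex C \<and>
            \<not> contractible_complex S C \<delta> \<and>
            acyclic_complex C \<delta> \<and>
            (\<forall>n. finitely_generated_module S (C n) \<and> projective_module S (C n))"
proof -
  let ?R = "poly_ring A :: (('x \<Rightarrow>\<^sub>0 nat) \<Rightarrow>\<^sub>0 'k) ring"
  let ?C = "Hom_complex_obj ?R (truncated_obj P) Q"
  let ?M = "residue_module :: (('x \<Rightarrow>\<^sub>0 nat) \<Rightarrow>\<^sub>0 'k, 'k) module"
  interpret cring_resolution ?R P d \<epsilon> ?M
    by (intro cring_resolution.intro cring_poly_ring cring_resolution_axioms.intro assms)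
  have Q: "left_module ?R Q" by (rule projective_module_left_module[OF assms(3)])
  interpret Q: left_module ?R Q by (rule Q)
  have retr: "mod_retract ?R (P n) Q" for n
    by (rule direct_summand_imp_retract[OF assms(4)])
  have T_retr: "mod_retract ?R (truncated_obj P n) Q" for n
    by (simp add: truncated_obj_def retr Q.mod_retract_zero_module)
  have reg: "\<exists>as. length as = n \<and> set as \<subseteq> carrier ?R \<and> regular_seq Q as \<and>
      (\<forall>a\<in>set as. \<forall>x\<in>carrier ?M. a \<odot>\<^bsub>?M\<^esub> x = \<zero>\<^bsub>?M\<^esub>)" for n
  proof -
    \<comment> \<open>Infinity of \<open>A\<close> supplies n distinct variables for every n. Their
      regularity passes from a free module to its retract \<open>Q\<close>, and they annihilate the
      residue module.\<close>
    obtain B where B: "finite B" "card B = n" "B \<subseteq> A"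
      using infinite_arbitrarily_large[OF assms(1)] by blast
    then obtain xs where xs: "set xs = B" "distinct xs" using finite_distinct_list by blast
    obtain I :: "'p set" where I: "mod_retract ?R Q (free_module ?R I)"
      using assms(3) direct_summand_imp_retract by (auto simp: projective_module_def)
    have vars: "set (map var xs) \<subseteq> carrier ?R" using B xs by (auto intro!: var_carrier)
    have "regular_seq Q (map var xs)"
      using regular_seq_retract[OF cring_poly_ring Q left_module_free_poly I vars] regular_seq_vars
        B xs by blast
    moreover have "length (map var xs) = n" using xs B distinct_card by fastforce
    moreover have "\<zero>\<^bsub>?M\<^esub> = 0" by (simp add: residue_module_def)
    ultimately show ?thesis
      using vars by (intro exI[of _ "map var xs"]) (simp add: residue_module_var)
  qed
  \<comment> \<open>In a field one differs from zero, so the residue module is nontrivial and a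
    contraction is impossible.\<close>
  have "1 \<in> carrier ?M" "1 \<noteq> \<zero>\<^bsub>?M\<^esub>" by (simp_all add: residue_module_def)
  then have "carrier ?M \<noteq> {\<zero>\<^bsub>?M\<^esub>}" by blast
  then have "\<not> contractible_complex (End_ring ?R Q) ?C
      (Hom_complex_diff ?R (truncated_obj P) (truncated_diff P d) Q)"
    using Hom_complex_contractible_imp_trivial[OF Q retr] by blast
  moreover have "finitely_generated_module (End_ring ?R Q) (?C n)"
    "projective_module (End_ring ?R Q) (?C n)" for n
    unfolding Hom_complex_obj_def
    by (intro Hom_module_finitely_generated Hom_module_projective truncated_module Q T_retr)+
  moreover have "bounded_below_complex ?C"
    unfolding bounded_below_complex_def using C_neg[OF Q] by blast
  ultimately show ?thesis
    unfolding Let_def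
    using Hom_complex[OF Q] Hom_complex_acyclic[OF Q reg] by blast
qed

end
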